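(* Let $d\mu_1(x;t),d\mu_2(y;t)$ be non-negative measures on $\mathbb{R}_+$ depending on $t$ with $\partial_t d\mu_1(x;t)=x\,d\mu_1(x;t)$, $\partial_t d\mu_2(y;t)=y\,d\mu_2(y;t)$, all moments finite and differentiable in $t$. With $\Delta_n(x)=\prod_{1\le j<k\le n}(x_k-x_j)$, define $$\tau_n=\frac{1}{(n!)^2}\int_{\mathbb{R}_+^n\times\mathbb{R}_+^n}\frac{\Delta_n^2(x)\Delta_n^2(y)}{\prod_{j,k=1}^n(x_j+y_k)}\prod_{j=1}^nd\mu_1(x_j;t)d\mu_2(y_j;t),$$ $$\hat\sigma_n=\frac{1}{n!(n+1)!}\int_{\mathbb{R}_+^{n+1}\times\mathbb{R}_+^n}\frac{\Delta_{n+1}^2(x)\Delta_n^2(y)}{\prod_{j=1}^{n+1}\prod_{k=1}^n(x_j+y_k)}\prod_{j=1}^{n+1}d\mu_1(x_j;t)\prod_{k=1}^nd\mu_2(y_k;t),$$ $$\sigma_n=\frac{1}{n!(n+1)!}\int_{\mathbb{R}_+^{n}\times\mathbb{R}_+^{n+1}}\frac{\Delta_{n}^2(x)\Delta_{n+1}^2(y)}{\prod_{j=1}^{n}\prod_{k=1}^{n+1}(x_j+y_k)}\prod_{j=1}^{n}d\mu_1(x_j;t)\prod_{k=1}^{n+1}d\mu_2(y_k;t),$$ $$\hat\xi_n=\frac{1}{(n!)^2}\int\frac{\Delta_n^2(x)\Delta_n^2(y)}{\prod_{j,k=1}^n(x_j+y_k)}\Big(\sum_{j=1}^ny_j\Big)\prod_{j=1}^nd\mu_1(x_j;t)d\mu_2(y_j;t),\quad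 \xi_n=\frac{1}{(n!)^2}\int\frac{\Delta_n^2(x)\Delta_n^2(y)}{\prod_{j,k=1}^n(x_j+y_k)}\Big(\sum_{j=1}^nx_j\Big)\prod_{j=1}^nd\mu_1(x_j;t)d\mu_2(y_j;t)$$ (integrals over $\mathbb{R}_+^n\times\mathbb{R}_+^n$), with $\tau_0=1$, and set $$A_n=\frac{\tau_{n+1}\tau_{n-1}}{\tau_n^2},\ B_n=\frac{\xi_{n+1}}{\tau_{n+1}}-\frac{\xi_n}{\tau_n},\ \hat B_n=\frac{\hat\xi_{n+1}}{\tau_{n+1}}-\frac{\hat\xi_n}{\tau_n},\ C_n=-\frac{\sigma_{n+1}\tau_n}{\sigma_n\tau_{n+1}},\ \hat C_n=-\frac{\hat\sigma_{n+1}\tau_n}{\hat\sigma_n\tau_{n+1}}.$$ Then these functions satisfy, for $n\ge2$, $$\partial_tA_n=A_n(B_n+\hat B_n-B_{n-1}-\hat B_{n-1}),$$ $$\partial_tB_n=(B_{n-1}+\hat B_{n-1})\hat C_{n-1}-(B_n+\hat B_n)\hat C_n,\qquad \partial_t\hat B_n=(B_{n-1}+\hat B_{n-1})C_{n-1}-(B_n+\hat B_n)C_n,$$ $$\partial_tC_n=C_n\Big(C_n-\frac{A_n}{C_{n-1}}-\hat B_n-C_{n+1}+\frac{A_{n+1}}{C_n}+\hat B_{n+1}\Big),\qquad \partial_t\hat C_n=\hat C_n\Big(\hat C_n-\frac{A_n}{\hat C_{n-1}}-B_n-\hat C_{n+1}+\frac{A_{n+1}}{\hat C_n}+B_{n+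1}\Big).$$
   Context: All quantities appearing in denominators ($\tau_n,\sigma_n,\hat\sigma_n,C_n,\hat C_n$) are assumed nonzero. *)

theory Defs
  imports "HOL-Analysis.Analysis"
begin

definition vdm :: "nat \<Rightarrow> (nat \<Rightarrow> real) \<Rightarrow> real" where
  "vdm n x = (\<Prod>k<n. \<Prod>j<k. (x k - x j))"

definition ckern :: "nat \<Rightarrow> nat \<Rightarrow> (nat \<Rightarrow> real) \<Rightarrow> (nat \<Rightarrow> real) \<Rightarrow> real" where
  "ckern m n x y = (vdm m x)^2 * (vdm n y)^2 / (\<Prod>j<m. \<Prod>k<n. (x j + y k))"

definition cint :: "nat \<Rightarrow> nat \<Rightarrow> (real \<Rightarrow> real measure) \<Rightarrow> (real \<Rightarrow> real measure) \<Rightarrow>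
    ((nat \<Rightarrow> real) \<Rightarrow> (nat \<Rightarrow> real) \<Rightarrow> real) \<Rightarrow> real \<Rightarrow> real" where
  "cint m n \<mu>1 \<mu>2 f t = (1 / (fact m * fact n)) *
     (\<integral>p. ckern m n (fst p) (snd p) * f (fst p) (snd p)
        \<partial>(PiM {..<m} (\<lambda>_. \<mu>1 t) \<Otimes>\<^sub>M PiM {..<n} (\<lambda>_. \<mu>2 t)))"

definition tau :: "(real \<Rightarrow> real measure) \<Rightarrow> (real \<Rightarrow> real measure) \<Rightarrow> nat \<Rightarrow> real \<Rightarrow> real" where
  "tau \<mu>1 \<mu>2 n = cint n n \<mu>1 \<mu>2 (\<lambda>x y. 1)"

definition sigma_hat :: "(real \<Rightarrow> real measure) \<Rightarrow> (real \<Rightarrow> real measure) \<Rightarrow> nat \<Rightarrow> real \<Rightarrow> real" where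
  "sigma_hat \<mu>1 \<mu>2 n = cint (Suc n) n \<mu>1 \<mu>2 (\<lambda>x y. 1)"

definition sigma :: "(real \<Rightarrow> real measure) \<Rightarrow> (real \<Rightarrow> real measure) \<Rightarrow> nat \<Rightarrow> real \<Rightarrow> real" where
  "sigma \<mu>1 \<mu>2 n = cint n (Suc n) \<mu>1 \<mu>2 (\<lambda>x y. 1)"

definition xi_hat :: "(real \<Rightarrow> real measure) \<Rightarrow> (real \<Rightarrow> real measure) \<Rightarrow> nat \<Rightarrow> real \<Rightarrow> real" where
  "xi_hat \<mu>1 \<mu>2 n = cint n n \<mu>1 \<mu>2 (\<lambda>x y. \<Sum>j<n. y j)"

definition xi :: "(real \<Rightarrow> real measure) \<Rightarrow> (real \<Rightarrow> real measure) \<Rightarrow> nat \<Rightarrow> real \<Rightarrow> real" where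
  "xi \<mu>1 \<mu>2 n = cint n n \<mu>1 \<mu>2 (\<lambda>x y. \<Sum>j<n. x j)"

definition cA :: "(real \<Rightarrow> real measure) \<Rightarrow> (real \<Rightarrow> real measure) \<Rightarrow> nat \<Rightarrow> real \<Rightarrow> real" where
  "cA \<mu>1 \<mu>2 n t = tau \<mu>1 \<mu>2 (Suc n) t * tau \<mu>1 \<mu>2 (n - 1) t / (tau \<mu>1 \<mu>2 n t)^2"

definition cB :: "(real \<Rightarrow> real measure) \<Rightarrow> (real \<Rightarrow> real measure) \<Rightarrow> nat \<Rightarrow> real \<Rightarrow> real" where
  "cB \<mu>1 \<mu>2 n t = xi \<mu>1 \<mu>2 (Suc n) t / tau \<mu>1 \<mu>2 (Suc n) t - xi \<mu>1 \<mu>2 n t / tau \<mu>1 \<mu>2 n t"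

definition cB_hat :: "(real \<Rightarrow> real measure) \<Rightarrow> (real \<Rightarrow> real measure) \<Rightarrow> nat \<Rightarrow> real \<Rightarrow> real" where
  "cB_hat \<mu>1 \<mu>2 n t = xi_hat \<mu>1 \<mu>2 (Suc n) t / tau \<mu>1 \<mu>2 (Suc n) t - xi_hat \<mu>1 \<mu>2 n t / tau \<mu>1 \<mu>2 n t"

definition cC :: "(real \<Rightarrow> real measure) \<Rightarrow> (real \<Rightarrow> real measure) \<Rightarrow> nat \<Rightarrow> real \<Rightarrow> real" where
  "cC \<mu>1 \<mu>2 n t = - (sigma \<mu>1 \<mu>2 (Suc n) t * tau \<mu>1 \<mu>2 n t) / (sigma \<mu>1 \<mu>2 n t * tau \<mu>1 \<mu>2 (Suc n) t)"

definition cC_hat :: "(real \<Rightarrow> real measure) \<Rightarrow> (real \<Rightarrow> real measure) \<Rightarrow> nat \<Rightarrow> real \<Rightarrow> real" where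
  "cC_hat \<mu>1 \<mu>2 n t = - (sigma_hat \<mu>1 \<mu>2 (Suc n) t * tau \<mu>1 \<mu>2 n t) / (sigma_hat \<mu>1 \<mu>2 n t * tau \<mu>1 \<mu>2 (Suc n) t)"

end

theory Submission
  imports Defs "Jordan_Normal_Form.Determinant"
begin

text \<open>
  Let \<open>I\<^sub>i\<^sub>j = \<integral>\<integral> x\<^sup>i y\<^sup>j / (x + y)\<close>, and let \<open>\<alpha>\<^sub>i\<close>, \<open>\<beta>\<^sub>j\<close> be the moments of the two measures. The flow
  gives \<open>I\<^sub>i\<^sub>j' = \<alpha>\<^sub>i \<beta>\<^sub>j = I\<^sub>i\<^sub>+\<^sub>1\<^sub>,\<^sub>j + I\<^sub>i\<^sub>,\<^sub>j\<^sub>+\<^sub>1\<close>. By Cauchy's determinant and Andreief's identity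
  \<open>\<tau>\<^sub>n\<close> is the leading principal minor \<open>det (I\<^sub>i\<^sub>j)\<close>; the \<open>\<sigma>\<close>'s are this minor bordered by one row \<open>\<beta>\<close> or
  column \<open>\<alpha>\<close>, and in the \<open>\<xi>\<close>'s the last row or column is shifted by one.

  Perform \<open>n\<close> steps of Gaussian elimination on the infinite matrix \<open>I\<close> and on the border, giving
  \<open>P\<close>, \<open>a\<close>, \<open>b\<close>. The rank one derivative is preserved, \<open>P\<^sub>i\<^sub>j' = a\<^sub>i b\<^sub>j\<close>, and the shift relation and
  \<open>\<beta>\<^sub>j' = \<beta>\<^sub>j\<^sub>+\<^sub>1\<close> survive with explicit corrections. All of \<open>A\<close>, \<open>B\<close>, \<open>C\<close> are rational in a few entries
  of \<open>P\<close>, \<open>a\<close>, \<open>b\<close> close to the pivots, so the equations follow from these three rules.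
\<close>

section \<open>Vandermonde and Cauchy determinants\<close>

text \<open>Arrays are indexed by all naturals and cut to a leading block only here, so minors of
  every size come from one array.\<close>

definition dt :: "nat \<Rightarrow> (nat \<Rightarrow> nat \<Rightarrow> real) \<Rightarrow> real" where
  "dt n f = Determinant.det (Matrix.mat n n (\<lambda>(i, j). f i j))"

lemma dt_permutes: "dt n f = (\<Sum>p | p permutes {..<n}. of_int (sign p) * (\<Prod>i<n. f i (p i)))"
proof -
  have "dt n f = (\<Sum>p | p permutes {0..<n}. of_int (sign p) *
      (\<Prod>i = 0..<n. Matrix.mat n n (\<lambda>(i, j). f i j) $$ (i, p i)))"
    unfolding dt_def by (rule det_def') simp
  also have "\<dots> = (\<Sum>p | p permutes {0..<n}. of_int (sign p) * (\<Prod>i = 0..<n. f i (p i)))"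
    by (intro sum.cong refl arg_cong2[where f="(*)"] prod.cong) (auto dest: permutes_in_image)
  finally show ?thesis by (simp add: atLeast0LessThan)
qed

lemma dt_cong: "(\<And>i j. i < n \<Longrightarrow> j < n \<Longrightarrow> f i j = g i j) \<Longrightarrow> dt n f = dt n g"
  unfolding dt_def by (intro arg_cong[where f=Determinant.det]) (auto intro!: eq_matI)

lemma dt_transpose: "dt n (\<lambda>i j. f j i) = dt n f"
proof -
  have "Matrix.mat n n (\<lambda>(i, j). f j i) = (Matrix.mat n n (\<lambda>(i, j). f i j))\<^sup>T"
    by (auto intro!: eq_matI)
  thus ?thesis unfolding dt_def using det_transpose[of "Matrix.mat n n (\<lambda>(i, j). f i j)" n] by simp
qed

lemma dt_mult: "dt n (\<lambda>i j. \<Sum>k<n. f i k * g k j) = dt n f * dt n g"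
proof -
  have "Matrix.mat n n (\<lambda>(i, j). \<Sum>k<n. f i k * g k j) =
     Matrix.mat n n (\<lambda>(i, j). f i j) * Matrix.mat n n (\<lambda>(i, j). g i j)"
    by (auto intro!: eq_matI simp: scalar_prod_def atLeast0LessThan)
  thus ?thesis unfolding dt_def
    using det_mult[of "Matrix.mat n n (\<lambda>(i, j). f i j)" n "Matrix.mat n n (\<lambda>(i, j). g i j)"] by simp
qed

lemma dt_lower_triangular:
  assumes "\<And>i j. i < j \<Longrightarrow> j < n \<Longrightarrow> f i j = 0"
  shows "dt n f = (\<Prod>i<n. f i i)"
proof -
  have "dt n f = prod_list (diag_mat (Matrix.mat n n (\<lambda>(i, j). f i j)))"
    unfolding dt_def by (rule det_lower_triangular[of n]) (use assms in auto)
  also have "\<dots> = (\<Prod>i = 0..<n. f i i)"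
    unfolding prod_list_diag_prod by (auto intro!: prod.cong)
  finally show ?thesis by (simp add: atLeast0LessThan)
qed

lemma dt_upper_triangular:
  assumes "\<And>i j. j < i \<Longrightarrow> i < n \<Longrightarrow> f i j = 0"
  shows "dt n f = (\<Prod>i<n. f i i)"
  using dt_lower_triangular[of n "\<lambda>i j. f j i"] assms dt_transpose[of n f] by simp

lemma dt_identical_rows:
  assumes "i \<noteq> j" "i < n" "j < n" "\<And>k. k < n \<Longrightarrow> f i k = f j k"
  shows "dt n f = 0"
  unfolding dt_def
  by (rule det_identical_rows[of _ n i j]) (use assms in \<open>auto intro!: eq_vecI\<close>)

lemma dt_permute_rows:
  assumes "q permutes {..<m}"
  shows "dt m (\<lambda>i. f (q i)) = of_int (sign q) * dt m f"
proof -
  let ?A = "Matrix.mat m m (\<lambda>(i, j). f i j)"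
  have q: "q permutes {0..<m}" using assms by (simp add: atLeast0LessThan)
  have "Determinant.det (Matrix.mat m m (\<lambda>(i, j). ?A $$ (q i, j))) = of_int (sign q) * dt m f"
    unfolding dt_def by (rule det_permute_rows[OF _ q]) simp
  moreover have "Matrix.mat m m (\<lambda>(i, j). ?A $$ (q i, j)) = Matrix.mat m m (\<lambda>(i, j). f (q i) j)"
    using permutes_in_image[OF q] by (intro eq_matI) auto
  ultimately show ?thesis by (simp add: dt_def)
qed

lemma dt_scale_rows: "dt n (\<lambda>i j. c i * f i j) = (\<Prod>i<n. c i) * dt n f"
  by (simp add: dt_permutes prod.distrib sum_distrib_left mult_ac)

lemma dt_scale_cols: "dt n (\<lambda>i j. c j * f i j) = (\<Prod>i<n. c i) * dt n f"
  using dt_scale_rows[of n c "\<lambda>i j. f j i"] dt_transpose[of n "\<lambda>i j. c j * f i j"] dt_transpose[of n f]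
  by simp

lemma dt_subtract_last_col:
  "dt (Suc n) (\<lambda>i j. if j < n then f i j - f i n else f i n) = dt (Suc n) f"
proof -
  \<comment> \<open>The identity with -1 in the rest of its last row. Multiplication by it on the
    right carries out all the column subtractions at once.\<close>
  let ?N = "\<lambda>k j. if k = j then 1 else if k = n then -1 else (0::real)"
  have "(\<Sum>k<Suc n. f i k * ?N k j) = (if j < n then f i j - f i n else f i n)"
    if "j < Suc n" for i j
    using that by (auto simp: less_Suc_eq if_distrib[of "(*) _"] sum.delta cong: if_cong)
  hence "dt (Suc n) (\<lambda>i j. if j < n then f i j - f i n else f i n) =
      dt (Suc n) (\<lambda>i j. \<Sum>k<Suc n. f i k * ?N k j)"
    by (intro dt_cong) simp
  also have "\<dots> = dt (Suc n) f" unfolding dt_mult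
    by (subst dt_lower_triangular[of _ ?N]) auto
  finally show ?thesis .
qed

lemma dt_subtract_last_row:
  "dt (Suc n) (\<lambda>i j. if i < n then f i j - f n j else f n j) = dt (Suc n) f"
  using dt_subtract_last_col[of n "\<lambda>i j. f j i"]
     dt_transpose[of "Suc n" "\<lambda>i j. if i < n then f i j - f n j else f n j"] dt_transpose[of "Suc n" f]
  by simp

lemma dt_last_row_unit:
  assumes "\<And>j. j < n \<Longrightarrow> f n j = 0" "f n n = 1"
  shows "dt (Suc n) f = dt n f"
proof -
  let ?A = "Matrix.mat (Suc n) (Suc n) (\<lambda>(i, j). f i j)"
  have "dt (Suc n) f = (\<Sum>j<Suc n. ?A $$ (n, j) * cofactor ?A n j)"
    unfolding dt_def by (rule laplace_expansion_row) auto
  also have "\<dots> = cofactor ?A n n" using assms by simp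
  also have "\<dots> = Determinant.det (mat_delete ?A n n)"
    by (simp add: cofactor_def flip: mult_2)
  also have "mat_delete ?A n n = Matrix.mat n n (\<lambda>(i, j). f i j)"
    by (auto intro!: eq_matI simp: mat_delete_def)
  finally show ?thesis by (simp add: dt_def)
qed

text \<open>Coordinates of the monomial of degree \<open>i\<close> in the Newton basis with nodes
  \<open>x 0\<close>, \<open>x 1\<close>, and so on. For \<open>k\<close> up to \<open>i\<close>
  they are the complete homogeneous polynomials of degree \<open>i - k\<close> in
  \<open>x 0\<close>, ..., \<open>x k\<close>.\<close>

fun newton_coeff :: "(nat \<Rightarrow> real) \<Rightarrow> nat \<Rightarrow> nat \<Rightarrow> real" where
  "newton_coeff x 0 0 = 1"
| "newton_coeff x 0 (Suc k) = 0"
| "newton_coeff x (Suc i) 0 = newton_coeff x i 0 * x 0"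
| "newton_coeff x (Suc i) (Suc k) = newton_coeff x i k + newton_coeff x i (Suc k) * x (Suc k)"

lemma newton_coeff_eq_0: "i < k \<Longrightarrow> newton_coeff x i k = 0"
  by (induction x i k rule: newton_coeff.induct) auto

lemma newton_coeff_diag: "newton_coeff x i i = 1"
  by (induction i) (auto simp: newton_coeff_eq_0)

lemma power_newton: "y ^ i = (\<Sum>k\<le>i. newton_coeff x i k * (\<Prod>l<k. y - x l))"
proof (induction i)
  case (Suc i)
  let ?p = "\<lambda>k. \<Prod>l<k. y - x l" and ?L = "newton_coeff x i"
  have "y ^ Suc i = (\<Sum>k\<le>i. ?L k * (y * ?p k))"
    by (simp add: Suc sum_distrib_left mult_ac)
  \<comment> \<open>Multiplication by \<open>y\<close> sends a Newton polynomial to the next one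
    plus \<open>x k\<close> times itself.\<close>
  also have "\<dots> = (\<Sum>k\<le>i. ?L k * ?p (Suc k) + ?L k * x k * ?p k)"
    by (intro sum.cong refl) (simp add: algebra_simps)
  also have "\<dots> = (\<Sum>k\<le>i. ?L k * ?p (Suc k)) + (\<Sum>k\<le>Suc i. ?L k * x k * ?p k)"
    by (simp add: sum.distrib newton_coeff_eq_0)
  also have "\<dots> = (\<Sum>k\<le>Suc i. newton_coeff x (Suc i) k * ?p k)"
    unfolding sum.atMost_Suc_shift
    by (simp add: distrib_right sum.distrib del: prod.lessThan_Suc)
  finally show ?case .
qed simp

text \<open>Expansion in the Newton basis factors the matrix of powers: a unit lower triangular
  matrix of coefficients times the Newton polynomials at the nodes. The latter is upper triangular
  because the polynomial of degree \<open>i\<close> vanishes at all earlier nodes.\<close>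

lemma vandermonde_dt: "dt n (\<lambda>i j. x j ^ i) = vdm n x"
proof -
  have "y ^ i = (\<Sum>k<n. newton_coeff x i k * (\<Prod>l<k. y - x l))" if "i < n" for i and y :: real
    unfolding power_newton[of y i x]
    by (rule sum.mono_neutral_left) (use that in \<open>auto simp: newton_coeff_eq_0\<close>)
  hence "dt n (\<lambda>i j. x j ^ i) = dt n (\<lambda>i j. \<Sum>k<n. newton_coeff x i k * (\<Prod>l<k. x j - x l))"
    by (intro dt_cong) simp
  also have "\<dots> = dt n (\<lambda>i j. \<Prod>l<i. x j - x l)"
    unfolding dt_mult by (subst dt_lower_triangular) (auto simp: newton_coeff_eq_0 newton_coeff_diag)
  also have "\<dots> = vdm n x"
    by (subst dt_upper_triangular) (auto simp: vdm_def)
  finally show ?thesis .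
qed

text \<open>
  Multiplying by \<open>\<Sum>j. x j\<close> raises one exponent at a time; unless it is the last one, two rows
  coincide.
\<close>

lemma vandermonde_sum_dt:
  "dt (Suc n) (\<lambda>i j. x j ^ (if i = n then Suc n else i)) = vdm (Suc n) x * (\<Sum>j<Suc n. x j)"
proof -
  let ?N = "Suc n"
  let ?P = "{p. p permutes {..<?N}}"
  have "vdm ?N x * (\<Sum>j<?N. x j) = (\<Sum>p\<in>?P. of_int (sign p) * (\<Prod>i<?N. x (p i) ^ i) * (\<Sum>j<?N. x j))"
    by (simp add: dt_permutes sum_distrib_right flip: vandermonde_dt)
  also have "\<dots> = (\<Sum>p\<in>?P. \<Sum>k<?N. of_int (sign p) * (\<Prod>i<?N. x (p i) ^ (if i = k then Suc i else i)))"
  proof (intro sum.cong refl)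
    fix p assume "p \<in> ?P"
    hence p: "p permutes {..<?N}" by simp
    have "(\<Sum>j<?N. x j) = (\<Sum>k<?N. x (p k))"
      using sum.permute[OF p, of x] by (simp add: o_def)
    moreover have "(\<Prod>i<?N. x (p i) ^ i) * x (p k) = (\<Prod>i<?N. x (p i) ^ (if i = k then Suc i else i))"
      if "k < ?N" for k
    proof -
      have "x (p k) = (\<Prod>i<?N. if i = k then x (p i) else 1)"
        by (subst prod.delta) (use that in auto)
      hence "(\<Prod>i<?N. x (p i) ^ i) * x (p k) = (\<Prod>i<?N. x (p i) ^ i * (if i = k then x (p i) else 1))"
        by (simp only: prod.distrib)
      also have "\<dots> = (\<Prod>i<?N. x (p i) ^ (if i = k then Suc i else i))"
        by (intro prod.cong) auto
      finally show ?thesis .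
    qed
    ultimately show "of_int (sign p) * (\<Prod>i<?N. x (p i) ^ i) * (\<Sum>j<?N. x j) =
       (\<Sum>k<?N. of_int (sign p) * (\<Prod>i<?N. x (p i) ^ (if i = k then Suc i else i)))"
      by (simp only: sum_distrib_left mult.assoc) (intro sum.cong, auto)
  qed
  also have "\<dots> = (\<Sum>k<?N. dt ?N (\<lambda>i j. x j ^ (if i = k then Suc i else i)))"
    by (subst sum.swap) (simp only: dt_permutes)
  also have "\<dots> = (\<Sum>k<?N. if k = n then dt ?N (\<lambda>i j. x j ^ (if i = n then Suc i else i)) else 0)"
  proof (intro sum.cong refl)
    fix k assume "k \<in> {..<?N}"
    then show "dt ?N (\<lambda>i j. x j ^ (if i = k then Suc i else i)) =
        (if k = n then dt ?N (\<lambda>i j. x j ^ (if i = n then Suc i else i)) else 0)"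
      using dt_identical_rows[of k "Suc k" ?N "\<lambda>i j. x j ^ (if i = k then Suc i else i)"] by auto
  qed
  also have "\<dots> = dt ?N (\<lambda>i j. x j ^ (if i = n then Suc n else i))"
    by (simp cong: if_cong)
  finally show ?thesis by simp
qed

text \<open>Subtracting the last column turns the row of ones into a unit vector. A difference of
  two Cauchy entries is again a Cauchy entry, times a factor of the row and a factor of the
  column.\<close>

lemma cauchy_dt_border:
  assumes "\<And>j k. j < Suc n \<Longrightarrow> k < n \<Longrightarrow> x j + y k \<noteq> 0"
  shows "dt (Suc n) (\<lambda>k j. if k < n then 1 / (x j + y k) else 1) =
    (\<Prod>j<n. x n - x j) / (\<Prod>k<n. x n + y k) * dt n (\<lambda>k j. 1 / (x j + y k))"
proof -
  let ?f = "\<lambda>k j. if k < n then 1 / (x j + y k) else (1::real)"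
  have "dt (Suc n) ?f = dt (Suc n) (\<lambda>k j. if j < n then ?f k j - ?f k n else ?f k n)"
    by (rule dt_subtract_last_col[symmetric])
  also have "\<dots> = dt n (\<lambda>k j. if j < n then ?f k j - ?f k n else ?f k n)"
    by (rule dt_last_row_unit) auto
  also have "\<dots> = dt n (\<lambda>k j. (1 / (x n + y k)) * ((x n - x j) * (1 / (x j + y k))))"
    using assms by (intro dt_cong) (auto simp: divide_simps)
  also have "\<dots> = (\<Prod>j<n. x n - x j) / (\<Prod>k<n. x n + y k) * dt n (\<lambda>k j. 1 / (x j + y k))"
    unfolding dt_scale_rows dt_scale_cols by (simp add: prod_dividef)
  finally show ?thesis .
qed

text \<open>Scaling column \<open>j\<close> by \<open>x j + y n\<close> makes the last row a row of
  ones. Subtracting that row leaves Cauchy entries with the row factor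
  \<open>y n - y k\<close>.\<close>

lemma cauchy_dt_Suc:
  assumes "\<And>j k. j < Suc n \<Longrightarrow> k < Suc n \<Longrightarrow> x j + y k \<noteq> 0"
  shows "dt (Suc n) (\<lambda>k j. 1 / (x j + y k)) =
    (\<Prod>k<n. y n - y k) / (\<Prod>j<Suc n. x j + y n) * dt (Suc n) (\<lambda>k j. if k < n then 1 / (x j + y k) else 1)"
proof -
  let ?f = "\<lambda>k j. (x j + y n) / (x j + y k)"
  have "dt (Suc n) (\<lambda>k j. 1 / (x j + y k)) = dt (Suc n) (\<lambda>k j. (1 / (x j + y n)) * ?f k j)"
    using assms by (intro dt_cong) auto
  also have "\<dots> = 1 / (\<Prod>j<Suc n. x j + y n) * dt (Suc n) ?f"
    unfolding dt_scale_cols by (simp only: prod_dividef prod.neutral_const)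
  also have "dt (Suc n) ?f = dt (Suc n) (\<lambda>k j. if k < n then ?f k j - ?f n j else ?f n j)"
    by (rule dt_subtract_last_row[symmetric])
  also have "\<dots> = dt (Suc n) (\<lambda>k j. (if k < n then y n - y k else 1) * (if k < n then 1 / (x j + y k) else 1))"
    using assms by (intro dt_cong) (auto simp: divide_simps)
  also have "\<dots> = (\<Prod>k<n. y n - y k) * dt (Suc n) (\<lambda>k j. if k < n then 1 / (x j + y k) else 1)"
    unfolding dt_scale_rows by simp
  finally show ?thesis by simp
qed

text \<open>Each induction step strips off \<open>y n\<close> by \<open>cauchy_dt_Suc\<close> and
  then \<open>x n\<close> by \<open>cauchy_dt_border\<close>.\<close>

lemma cauchy_dt:
  assumes "\<And>j k. j < n \<Longrightarrow> k < n \<Longrightarrow> x j + y k \<noteq> 0"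
  shows "dt n (\<lambda>k j. 1 / (x j + y k)) = vdm n x * vdm n y / (\<Prod>j<n. \<Prod>k<n. x j + y k)"
  using assms
proof (induction n)
  case 0
  show ?case by (simp add: dt_def vdm_def)
next
  case (Suc n)
  have "dt n (\<lambda>k j. 1 / (x j + y k)) = vdm n x * vdm n y / (\<Prod>j<n. \<Prod>k<n. x j + y k)"
    using Suc by simp
  moreover have "dt (Suc n) (\<lambda>k j. 1 / (x j + y k)) =
      (\<Prod>k<n. y n - y k) / (\<Prod>j<Suc n. x j + y n) *
        ((\<Prod>j<n. x n - x j) / (\<Prod>k<n. x n + y k) * dt n (\<lambda>k j. 1 / (x j + y k)))"
    using Suc.prems by (subst cauchy_dt_Suc, simp, subst cauchy_dt_border) simp_all
  ultimately show ?case
    by (simp add: vdm_def prod.distrib mult_ac)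
qed

text \<open>Stopping halfway through that step gives the kernel for one more \<open>x\<close> than
  \<open>y\<close>, as it occurs in \<open>sigma_hat\<close>.\<close>

lemma cauchy_dt_bordered:
  assumes "\<And>j k. j < Suc n \<Longrightarrow> k < n \<Longrightarrow> x j + y k \<noteq> 0"
  shows "dt (Suc n) (\<lambda>k j. if k < n then 1 / (x j + y k) else 1) =
    vdm (Suc n) x * vdm n y / (\<Prod>j<Suc n. \<Prod>k<n. x j + y k)"
proof -
  have "dt n (\<lambda>k j. 1 / (x j + y k)) = vdm n x * vdm n y / (\<Prod>j<n. \<Prod>k<n. x j + y k)"
    using assms by (intro cauchy_dt) simp
  then show ?thesis
    by (subst cauchy_dt_border[OF assms]) (simp_all add: vdm_def mult_ac)
qed

section \<open>Gaussian elimination\<close>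

text \<open>
  \<open>elim F n\<close> is the Schur complement of the leading \<open>n \<times> n\<close> block of \<open>F\<close>, and \<open>elim_row F b n\<close> is the result
  of the same elimination on an extra row \<open>b\<close>. Both carry junk values as soon as a pivot
  \<open>elim F k k k\<close> with \<open>k < n\<close> vanishes.
\<close>

fun elim :: "(nat \<Rightarrow> nat \<Rightarrow> real) \<Rightarrow> nat \<Rightarrow> nat \<Rightarrow> nat \<Rightarrow> real" where
  "elim F 0 i j = F i j"
| "elim F (Suc n) i j = elim F n i j - elim F n i n * elim F n n j / elim F n n n"

fun elim_row :: "(nat \<Rightarrow> nat \<Rightarrow> real) \<Rightarrow> (nat \<Rightarrow> real) \<Rightarrow> nat \<Rightarrow> nat \<Rightarrow> real" where
  "elim_row F b 0 j = b j"
| "elim_row F b (Suc n) j = elim_row F b n j - elim_row F b n n * elim F n n j / elim F n n n"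

text \<open>The multiplier used in the last of \<open>n\<close> elimination steps, which is also the
  weight of the original row \<open>n - 1\<close> in all that has been subtracted from
  \<open>b\<close>. Before the first step nothing has been subtracted, hence the value 0.\<close>

fun elim_coeff :: "(nat \<Rightarrow> nat \<Rightarrow> real) \<Rightarrow> (nat \<Rightarrow> real) \<Rightarrow> nat \<Rightarrow> real" where
  "elim_coeff F b 0 = 0"
| "elim_coeff F b (Suc n) = elim_row F b n n / elim F n n n"

abbreviation (input) transposed :: "('a \<Rightarrow> 'b \<Rightarrow> 'c) \<Rightarrow> 'b \<Rightarrow> 'a \<Rightarrow> 'c" where
  "transposed F \<equiv> \<lambda>i j. F j i"

lemma elim_transp: "elim (transposed F) n i j = elim F n j i"
  by (induction n arbitrary: i j) (auto simp: mult.commute)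

lemma elim_row_self: "elim_row F (F i) n j = elim F n i j"
  by (induction n arbitrary: j) auto

text \<open>Eliminating row \<open>i\<close> subtracts a combination of the rows with index less
  than \<open>n\<close>. Shifting this combination by one gives rows that are eliminated as well,
  except that row \<open>n - 1\<close> becomes row \<open>n\<close>; its weight is
  \<open>elim_coeff F (F i) n\<close>. Columns behave in the same way, which accounts for the two
  correction terms.\<close>

lemma elim_shift:
  assumes "\<And>i j. F (Suc i) j + F i (Suc j) = \<alpha> i * \<beta> j"
    and "\<And>k. k < n \<Longrightarrow> elim F k k k \<noteq> 0"
  shows "elim F n (Suc i) j + elim F n i (Suc j) =
    elim_row (transposed F) \<alpha> n i * elim_row F \<beta> n j
      + elim_coeff F (F i) n * elim F n n j + elim_coeff (transposed F) (transposed F j) n * elim F n i n"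
  using assms(2)
proof (induction n arbitrary: i j)
  case 0
  then show ?case using assms(1) by simp
next
  case (Suc n)
  define P where "P = elim F n"
  define a where "a = elim_row (transposed F) \<alpha> n"
  define b where "b = elim_row F \<beta> n"
  define c where "c i = elim_coeff F (F i) n" for i
  define d where "d j = elim_coeff (transposed F) (transposed F j) n" for j
  have q: "P n n \<noteq> 0" using Suc.prems[of n] by (simp add: P_def)
  have IH: "P i (Suc j) = a i * b j + c i * P n j + d j * P i n - P (Suc i) j" for i j
    using Suc.IH[of i j] Suc.prems by (simp add: P_def a_def b_def c_def d_def)
  \<comment> \<open>With a name for the reciprocal pivot the claim is a polynomial identity modulo
    \<open>P n n * r = 1\<close>, which Groebner bases decide. The induction hypothesis first trades
    column shifts for row shifts.\<close>
  define r where "r = 1 / P n n"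
  have "P n n * r = 1" using q by (simp add: r_def)
  then have "P (Suc i) j - P (Suc i) n * P n j * r + (P i (Suc j) - P i n * P n (Suc j) * r) =
    (a i - a n * P i n * r) * (b j - b n * P n j * r)
     + P i n * r * (P (Suc n) j - P (Suc n) n * P n j * r)
     + P n j * r * (P i (Suc n) - P i n * P n (Suc n) * r)"
    unfolding IH by Groebner_Basis.algebra
  then show ?case
    by (simp add: elim_transp[of F] elim_row_self[of F] elim_row_self[of "transposed F"] r_def
        flip: P_def a_def b_def)
qed

text \<open>By the quotient rule, one elimination step on an array with derivative
  \<open>a i * b j\<close> gives an array whose derivative is the product of the same step applied
  to \<open>a\<close> and to \<open>b\<close>.\<close>

lemma has_derivative_elim:
  fixes F :: "real \<Rightarrow> nat \<Rightarrow> nat \<Rightarrow> real"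
  assumes "\<And>i j. ((\<lambda>s. F s i j) has_real_derivative \<alpha> i * \<beta> j) (at t)"
    and "\<And>k. k < n \<Longrightarrow> elim (F t) k k k \<noteq> 0"
  shows "((\<lambda>s. elim (F s) n i j) has_real_derivative
    elim_row (transposed (F t)) \<alpha> n i * elim_row (F t) \<beta> n j) (at t)"
  using assms(2)
proof (induction n arbitrary: i j)
  case 0
  then show ?case using assms(1) by simp
next
  case (Suc n)
  have q: "elim (F t) n n n \<noteq> 0" using Suc.prems[of n] by simp
  define P where "P = elim (F t) n"
  define a where "a = elim_row (transposed (F t)) \<alpha> n"
  define b where "b = elim_row (F t) \<beta> n"
  define r where "r = 1 / P n n"
  have q': "P n n \<noteq> 0" and r: "P n n * r = 1" using q by (auto simp: P_def r_def)
  have IH: "((\<lambda>s. elim (F s) n i j) has_real_derivative a i * b j) (at t)" for i j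
    using Suc by (auto simp: a_def b_def)
  have "((\<lambda>s. elim (F s) (Suc n) i j) has_real_derivative
     a i * b j - ((a i * b n * P n j + a n * b j * P i n) * P n n
         - P i n * P n j * (a n * b n)) / (P n n * P n n)) (at t)"
    unfolding elim.simps P_def
    by (rule DERIV_diff[OF IH DERIV_divide[OF DERIV_mult[OF IH IH] IH q]])
  also have "a i * b j - ((a i * b n * P n j + a n * b j * P i n) * P n n
         - P i n * P n j * (a n * b n)) / (P n n * P n n) =
     a i * b j - ((a i * b n * P n j + a n * b j * P i n) * r
         - P i n * P n j * (a n * b n) * r * r)"
    using q' unfolding r_def by (simp add: diff_divide_distrib)
  also have "\<dots> = (a i - a n * P i n * r) * (b j - b n * P n j * r)"
    by Groebner_Basis.algebra
  also have "\<dots> = elim_row (transposed (F t)) \<alpha> (Suc n) i * elim_row (F t) \<beta> (Suc n) j"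
    by (simp add: elim_transp[of "F t"] r_def flip: P_def a_def b_def)
  finally show ?case .
qed

text \<open>Both the row and the multipliers move. The shift relation cancels the motion of the
  multipliers except at the edge of the eliminated block: column \<open>n - 1\<close> is shifted
  into column \<open>n\<close>, and row \<open>n - 1\<close> into row \<open>n\<close>. These leave
  the two corrections.\<close>

lemma has_derivative_elim_row:
  fixes F :: "real \<Rightarrow> nat \<Rightarrow> nat \<Rightarrow> real"
  assumes dF: "\<And>i j. ((\<lambda>s. F s i j) has_real_derivative \<alpha> i * \<beta> t j) (at t)"
    and dbeta: "\<And>j. ((\<lambda>s. \<beta> s j) has_real_derivative \<beta> t (Suc j)) (at t)"
    and shift: "\<And>i j. F t (Suc i) j + F t i (Suc j) = \<alpha> i * \<beta> t j"
    and nz: "\<And>k. k < n \<Longrightarrow> elim (F t) k k k \<noteq> 0"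
  shows "((\<lambda>s. elim_row (F s) (\<beta> s) n j) has_real_derivative
    elim_row (F t) (\<beta> t) n (Suc j)
      - elim_coeff (transposed (F t)) (transposed (F t) j) n * elim_row (F t) (\<beta> t) n n
      - elim_coeff (F t) (\<beta> t) n * elim (F t) n n j) (at t)"
  using nz
proof (induction n arbitrary: j)
  case 0
  then show ?case using dbeta by simp
next
  case (Suc n)
  define P where "P = elim (F t) n"
  define a where "a = elim_row (transposed (F t)) \<alpha> n"
  define b where "b = elim_row (F t) (\<beta> t) n"
  define c where "c i = elim_coeff (F t) (F t i) n" for i
  define d where "d j = elim_coeff (transposed (F t)) (transposed (F t) j) n" for j
  define e where "e = elim_coeff (F t) (\<beta> t) n"
  have q: "elim (F t) n n n \<noteq> 0" using Suc.prems[of n] by simp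
  hence q': "P n n \<noteq> 0" by (simp add: P_def)
  have IH: "((\<lambda>s. elim_row (F s) (\<beta> s) n j) has_real_derivative
      b (Suc j) - d j * b n - e * P n j) (at t)" for j
    using Suc by (simp add: P_def b_def d_def e_def)
  have el: "((\<lambda>s. elim (F s) n i j) has_real_derivative a i * b j) (at t)" for i j
    using has_derivative_elim[OF dF, of n] Suc.prems by (simp add: a_def b_def)
  have sh: "P i (Suc j) = a i * b j + c i * P n j + d j * P i n - P (Suc i) j" for i j
    using elim_shift[of "F t" \<alpha> "\<beta> t" n i j, OF shift] Suc.prems by (simp add: P_def a_def b_def c_def d_def)
  define r where "r = 1 / P n n"
  have r: "P n n * r = 1" using q' by (simp add: r_def)
  have "((\<lambda>s. elim_row (F s) (\<beta> s) (Suc n) j) has_real_derivative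
     b (Suc j) - d j * b n - e * P n j
     - (((b (Suc n) - d n * b n - e * P n n) * P n j + a n * b j * b n) * P n n
         - b n * P n j * (a n * b n)) / (P n n * P n n)) (at t)"
    unfolding elim_row.simps
    using DERIV_diff[OF IH DERIV_divide[OF DERIV_mult[OF IH el] el q]]
    by (simp add: P_def b_def)
  also have "b (Suc j) - d j * b n - e * P n j
     - (((b (Suc n) - d n * b n - e * P n n) * P n j + a n * b j * b n) * P n n
         - b n * P n j * (a n * b n)) / (P n n * P n n) =
    b (Suc j) - d j * b n - e * P n j
     - (((b (Suc n) - d n * b n - e * P n n) * P n j + a n * b j * b n) * r
         - b n * P n j * (a n * b n) * r * r)"
    using q' unfolding r_def by (simp add: diff_divide_distrib)
  also have "\<dots> = b (Suc j) - b n * P n (Suc j) * r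
      - P n j * r * (b (Suc n) - b n * P n (Suc n) * r)
      - b n * r * (P (Suc n) j - P (Suc n) n * P n j * r)"
    unfolding sh using r by Groebner_Basis.algebra
  also have "\<dots> =
    elim_row (F t) (\<beta> t) (Suc n) (Suc j)
      - elim_coeff (transposed (F t)) (transposed (F t) j) (Suc n) * elim_row (F t) (\<beta> t) (Suc n) (Suc n)
      - elim_coeff (F t) (\<beta> t) (Suc n) * elim (F t) (Suc n) (Suc n) j"
    by (simp add: elim_transp[of "F t"] elim_row_self[of "F t"] elim_row_self[of "transposed (F t)"] r_def
        flip: P_def b_def)
  finally show ?case .
qed

section \<open>Triangular factorization and bordered minors\<close>

lemma elim_row_telescope:
  "b j = (\<Sum>k<n. elim_row F b k k * elim F k k j / elim F k k k) + elim_row F b n j"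
  by (induction n) auto

lemma elim_row_eq_0:
  assumes "\<And>k. k < n \<Longrightarrow> elim F k k k \<noteq> 0" "j < n"
  shows "elim_row F b n j = 0"
  using assms
proof (induction n arbitrary: b)
  case (Suc n)
  show ?case
  proof (cases "j = n")
    case True
    then show ?thesis using Suc.prems by simp
  next
    case False
    \<comment> \<open>The claim is kept general in \<open>b\<close> because the next step also needs
      it for the pivot row \<open>F n\<close>.\<close>
    have "elim_row F b n j = 0" for b
      by (rule Suc.IH) (use False Suc.prems in auto)
    from this[of b] this[of "F n"] show ?thesis by (simp add: elim_row_self)
  qed
qed simp

lemma elim_eq_0:
  assumes "\<And>k. k < n \<Longrightarrow> elim F k k k \<noteq> 0"
  shows "j < n \<Longrightarrow> elim F n i j = 0" "i < n \<Longrightarrow> elim F n i j = 0"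
  using elim_row_eq_0[of n F j "F i"] elim_row_eq_0[of n "transposed F" i "transposed F j"] assms
  by (auto simp: elim_row_self[of F] elim_row_self[of "transposed F"] elim_transp[of F])

text \<open>This is an LU factorization: the multipliers form a unit lower triangular matrix, and
  the pivot rows followed by the eliminated border form an upper triangular one.\<close>

lemma dt_elim_row:
  assumes nz: "\<And>k. k < n \<Longrightarrow> elim F k k k \<noteq> 0"
  shows "dt (Suc n) (\<lambda>i j. if i < n then F i j else b j) = (\<Prod>k<n. elim F k k k) * elim_row F b n n"
proof -
  define L where "L i k = (if k < n then elim_row F (if i < n then F i else b) k k / elim F k k k
    else if i < n then 0 else 1)" for i k
  define U where "U k j = (if k < n then elim F k k j else elim_row F b n j)" for k j
  \<comment> \<open>After \<open>n\<close> steps the first \<open>n\<close> rows have no remainder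
    left, so only the border row meets the last row of \<open>U\<close>.\<close>
  have z: "elim F n i j = 0" if "i < n" for i j
    using elim_eq_0[of n F] nz that by auto
  have "(if i < n then F i j else b j) = (\<Sum>k<Suc n. L i k * U k j)" for i j
    using elim_row_telescope[of "if i < n then F i else b" j F n] z[of i j]
    by (auto simp: L_def U_def elim_row_self[of F])
  hence "dt (Suc n) (\<lambda>i j. if i < n then F i j else b j) = dt (Suc n) L * dt (Suc n) U"
    by (simp only: dt_mult)
  also have "dt (Suc n) L = (\<Prod>k<Suc n. L k k)"
  proof (rule dt_lower_triangular)
    fix i j assume "i < j" "j < Suc n"
    then show "L i j = 0"
      using elim_eq_0(2)[of j F i j] nz by (auto simp: L_def elim_row_self[of F])
  qed
  also have "\<dots> = 1" using nz by (intro prod.neutral) (auto simp: L_def elim_row_self[of F])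
  also have "dt (Suc n) U = (\<Prod>k<Suc n. U k k)"
  proof (rule dt_upper_triangular)
    fix i j assume "j < i" "i < Suc n"
    then show "U i j = 0"
      using elim_eq_0(1)[of i F j i] elim_row_eq_0[of n F j b] nz by (auto simp: U_def)
  qed
  finally show ?thesis by (simp add: U_def)
qed

section \<open>Elimination along the moment flow\<close>

text \<open>Logarithmic derivatives of a quotient subtract; written with \<open>f t * D\<close> so
  that no division by \<open>f t\<close> occurs.\<close>

lemma DERIV_quotient_log:
  fixes f g :: "real \<Rightarrow> real"
  assumes "(f has_real_derivative f t * D) (at t)" "(g has_real_derivative g t * E) (at t)" "g t \<noteq> 0"
  shows "((\<lambda>s. f s / g s) has_real_derivative f t / g t * (D - E)) (at t)"
  by (rule DERIV_cong[OF DERIV_divide[OF assms]]) (use assms(3) in \<open>simp add: field_simps\<close>)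

text \<open>Collects what the integrable system needs at a single time. The roles of rows and
  columns are interchangeable apart from \<open>dbeta\<close>, so a second instance with the array
  transposed yields the mirrored equations.\<close>

locale moment_flow =
  fixes F :: "real \<Rightarrow> nat \<Rightarrow> nat \<Rightarrow> real" and \<alpha> \<beta> :: "real \<Rightarrow> nat \<Rightarrow> real" and t :: real
  assumes dF: "\<And>i j. ((\<lambda>s. F s i j) has_real_derivative \<alpha> t i * \<beta> t j) (at t)"
    and dbeta: "\<And>j. ((\<lambda>s. \<beta> s j) has_real_derivative \<beta> t (Suc j)) (at t)"
    and shift: "\<And>i j. F t (Suc i) j + F t i (Suc j) = \<alpha> t i * \<beta> t j"
    and pivot: "\<And>n. elim (F t) n n n \<noteq> 0"
    and row_nz: "\<And>n. elim_row (F t) (\<beta> t) n n \<noteq> 0"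
    and col_nz: "\<And>n. elim_row (transposed (F t)) (\<alpha> t) n n \<noteq> 0"
begin

text \<open>
  For the flow of the theorem, \<open>A\<^sub>n = piv n / piv (n - 1)\<close>, \<open>C\<^sub>n = - brow (n + 1) / brow n\<close>, and
  \<open>B\<^sub>n\<close> and its hatted version are the increments of \<open>lcoeff\<close>, \<open>rcoeff\<close>. The hatted \<open>C\<close> uses \<open>acol\<close>.
\<close>

definition piv where "piv n s = elim (F s) n n n"
definition acol where "acol n s = elim_row (transposed (F s)) (\<alpha> s) n n"
definition brow where "brow n s = elim_row (F s) (\<beta> s) n n"
definition lcoeff where "lcoeff n s = elim_coeff (F s) (F s n) n"
definition rcoeff where "rcoeff n s = elim_coeff (transposed (F s)) (transposed (F s) n) n"

lemma nz: "piv n t \<noteq> 0" "acol n t \<noteq> 0" "brow n t \<noteq> 0"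
  using pivot row_nz col_nz by (auto simp: piv_def acol_def brow_def)

lemma DERIV_piv: "(piv n has_real_derivative acol n t * brow n t) (at t)"
  using has_derivative_elim[of F "\<alpha> t" "\<beta> t" t n n n, OF dF] pivot unfolding piv_def acol_def brow_def by simp

text \<open>The shift relation at the pivot entry, divided by the pivot: the two shifted entries
  become the next coefficients. The right side is the logarithmic derivative of the pivot.\<close>

lemma lcoeff_rcoeff_diff: "lcoeff (Suc n) t + rcoeff (Suc n) t - lcoeff n t - rcoeff n t = acol n t * brow n t / piv n t"
  using elim_shift[of "F t" "\<alpha> t" "\<beta> t" n n n, OF shift] pivot[of n] pivot
  by (simp add: lcoeff_def rcoeff_def acol_def brow_def piv_def elim_row_self[of "F t"] elim_row_self[of "transposed (F t)"]
      elim_transp[of "F t"] field_simps)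

text \<open>In the quotient rule \<open>brow n t\<close> factors out, and what remains is one
  further elimination step on the column \<open>\<alpha>\<close>, that is
  \<open>acol (Suc n) t\<close>.\<close>

lemma DERIV_lcoeff: "(lcoeff (Suc n) has_real_derivative brow n t * acol (Suc n) t / piv n t) (at t)"
proof -
  let ?c = "elim_row (transposed (F t)) (\<alpha> t) n (Suc n)" and ?x = "elim (F t) n (Suc n) n"
  have "lcoeff (Suc n) = (\<lambda>s. elim (F s) n (Suc n) n / piv n s)"
    by (auto simp: lcoeff_def piv_def elim_row_self)
  moreover have "((\<lambda>s. elim (F s) n (Suc n) n / piv n s) has_real_derivative
      (?c * brow n t * piv n t - ?x * (acol n t * brow n t)) / (piv n t * piv n t)) (at t)"
    using DERIV_divide[OF has_derivative_elim[of F "\<alpha> t" "\<beta> t" t n "Suc n" n, OF dF] DERIV_piv[of n] nz(1)] pivot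
    by (simp add: brow_def)
  moreover have "acol (Suc n) t = ?c - acol n t * ?x / piv n t"
    by (simp add: acol_def piv_def elim_transp[of "F t"])
  ultimately show ?thesis using nz(1)[of n]
    by (simp add: diff_divide_distrib right_diff_distrib mult_ac)
qed

text \<open>The rule for eliminated rows at \<open>j = n\<close>; the entry just right of the
  diagonal is expressed through \<open>brow (Suc n) t\<close> by undoing one elimination
  step.\<close>

lemma DERIV_brow: "(brow n has_real_derivative brow (Suc n) t + brow n t * (rcoeff (Suc n) t - rcoeff n t)
    - elim_coeff (F t) (\<beta> t) n * piv n t) (at t)"
proof -
  have "(brow n has_real_derivative elim_row (F t) (\<beta> t) n (Suc n) - rcoeff n t * brow n t
     - elim_coeff (F t) (\<beta> t) n * piv n t) (at t)"
    using has_derivative_elim_row[of F "\<alpha> t" \<beta> t n n, OF dF dbeta shift] pivot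
    unfolding brow_def rcoeff_def piv_def by simp
  moreover have "brow (Suc n) t = elim_row (F t) (\<beta> t) n (Suc n) - brow n t * rcoeff (Suc n) t"
    by (simp add: brow_def rcoeff_def elim_row_self[of "transposed (F t)"] elim_transp[of "F t"])
  ultimately show ?thesis by (simp add: algebra_simps)
qed

lemma DERIV_piv_quotient: "((\<lambda>s. piv (Suc n) s / piv n s) has_real_derivative
   piv (Suc n) t / piv n t * ((lcoeff (Suc (Suc n)) t - lcoeff (Suc n) t) + (rcoeff (Suc (Suc n)) t - rcoeff (Suc n) t)
      - (lcoeff (Suc n) t - lcoeff n t) - (rcoeff (Suc n) t - rcoeff n t))) (at t)"
proof -
  have eq: "(lcoeff (Suc (Suc n)) t - lcoeff (Suc n) t) + (rcoeff (Suc (Suc n)) t - rcoeff (Suc n) t)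
      - (lcoeff (Suc n) t - lcoeff n t) - (rcoeff (Suc n) t - rcoeff n t) =
      acol (Suc n) t * brow (Suc n) t / piv (Suc n) t - acol n t * brow n t / piv n t"
    using lcoeff_rcoeff_diff[of n] lcoeff_rcoeff_diff[of "Suc n"] by linarith
  show ?thesis unfolding eq
    by (rule DERIV_cong[OF DERIV_divide[OF DERIV_piv DERIV_piv nz(1)]]) (use nz in \<open>simp add: field_simps\<close>)
qed

lemma DERIV_lcoeff_diff: "((\<lambda>s. lcoeff (Suc (Suc n)) s - lcoeff (Suc n) s) has_real_derivative
   ((lcoeff (Suc n) t - lcoeff n t) + (rcoeff (Suc n) t - rcoeff n t)) * (- acol (Suc n) t / acol n t)
    - ((lcoeff (Suc (Suc n)) t - lcoeff (Suc n) t) + (rcoeff (Suc (Suc n)) t - rcoeff (Suc n) t))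
       * (- acol (Suc (Suc n)) t / acol (Suc n) t)) (at t)"
proof -
  have eq: "(lcoeff (Suc n) t - lcoeff n t) + (rcoeff (Suc n) t - rcoeff n t) = acol n t * brow n t / piv n t" for n
    using lcoeff_rcoeff_diff[of n] by linarith
  show ?thesis unfolding eq
    by (rule DERIV_cong[OF DERIV_diff[OF DERIV_lcoeff DERIV_lcoeff]]) (use nz in simp)
qed

lemma DERIV_brow_quotient: "((\<lambda>s. - brow (Suc (Suc n)) s / brow (Suc n) s) has_real_derivative
   (- brow (Suc (Suc n)) t / brow (Suc n) t) *
     (- brow (Suc (Suc n)) t / brow (Suc n) t - (piv (Suc n) t / piv n t) / (- brow (Suc n) t / brow n t)
       - (rcoeff (Suc (Suc n)) t - rcoeff (Suc n) t) - (- brow (Suc (Suc (Suc n))) t / brow (Suc (Suc n)) t)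
       + (piv (Suc (Suc n)) t / piv (Suc n) t) / (- brow (Suc (Suc n)) t / brow (Suc n) t)
       + (rcoeff (Suc (Suc (Suc n))) t - rcoeff (Suc (Suc n)) t))) (at t)"
proof -
  \<comment> \<open>The logarithmic derivative of \<open>brow (Suc n)\<close>. At a successor index
    the coefficient of \<open>\<beta>\<close> is \<open>brow n t / piv n t\<close>, and this
    produces the quotient of A by the preceding C.\<close>
  let ?D = "\<lambda>n. brow (Suc (Suc n)) t / brow (Suc n) t + (rcoeff (Suc (Suc n)) t - rcoeff (Suc n) t)
     - brow n t / piv n t * piv (Suc n) t / brow (Suc n) t"
  have db: "(brow (Suc n) has_real_derivative brow (Suc n) t * ?D n) (at t)" for n
    by (rule DERIV_cong[OF DERIV_brow]) (use nz in \<open>simp add: brow_def[of n] piv_def[of n] field_simps\<close>)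
  have "((\<lambda>s. - brow (Suc (Suc n)) s / brow (Suc n) s) has_real_derivative
     (- brow (Suc (Suc n)) t / brow (Suc n) t) * (?D (Suc n) - ?D n)) (at t)"
    using DERIV_minus[OF DERIV_quotient_log[OF db[of "Suc n"] db[of n] nz(3)]] by simp
  also have "?D (Suc n) - ?D n =
     - brow (Suc (Suc n)) t / brow (Suc n) t - (piv (Suc n) t / piv n t) / (- brow (Suc n) t / brow n t)
       - (rcoeff (Suc (Suc n)) t - rcoeff (Suc n) t) - (- brow (Suc (Suc (Suc n))) t / brow (Suc (Suc n)) t)
       + (piv (Suc (Suc n)) t / piv (Suc n) t) / (- brow (Suc (Suc n)) t / brow (Suc n) t)
       + (rcoeff (Suc (Suc (Suc n))) t - rcoeff (Suc (Suc n)) t)"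
    using nz by (simp add: mult.commute)
  finally show ?thesis .
qed

end

section \<open>Multiple integrals with a Cauchy kernel\<close>

text \<open>Points that violate \<open>P\<close> in one coordinate lie in a box with one null side.
  A finite product of measures with a zero factor is zero.\<close>

lemma AE_PiM_all:
  fixes M :: "'a measure" and I :: "'i set"
  assumes "sigma_finite_measure M" "finite I" "AE x in M. P x"
  shows "AE x in PiM I (\<lambda>_. M). \<forall>i\<in>I. P (x i)"
proof (subst AE_finite_all[OF \<open>finite I\<close>], intro ballI)
  fix i assume i: "i \<in> I"
  interpret product_sigma_finite "\<lambda>_. M" using assms(1) by (simp add: product_sigma_finite_def)
  from assms(3) obtain Z where Z: "Z \<in> null_sets M" "{x \<in> space M. \<not> P x} \<subseteq> Z"
    by (auto simp: eventually_ae_filter)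
  let ?A = "\<lambda>j. if j = i then Z else space M"
  have "?A j \<in> sets M" for j using Z by auto
  hence "Pi\<^sub>E I ?A \<in> null_sets (PiM I (\<lambda>_. M))"
    using i Z emeasure_PiM[of I ?A] assms(2)
    by (auto simp: null_sets_def intro!: sets_PiM_I_finite bexI[of _ i])
  moreover have "{x \<in> space (PiM I (\<lambda>_. M)). \<not> P (x i)} \<subseteq> Pi\<^sub>E I ?A"
    using Z i by (auto simp: space_PiM PiE_iff extensional_def)
  ultimately show "AE x in PiM I (\<lambda>_. M). P (x i)"
    by (auto simp: eventually_ae_filter)
qed

lemma integrable_pair_mult:
  fixes f g :: "_ \<Rightarrow> real"
  assumes "sigma_finite_measure M" "sigma_finite_measure N" "integrable M f" "integrable N g"
  shows "integrable (M \<Otimes>\<^sub>M N) (\<lambda>p. f (fst p) * g (snd p))"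
proof -
  interpret pair_sigma_finite M N using assms by (simp add: pair_sigma_finite_def)
  have [measurable]: "f \<in> borel_measurable M" "g \<in> borel_measurable N" using assms by auto
  show ?thesis
    by (rule Fubini_integrable) (use assms in \<open>auto simp: abs_mult\<close>)
qed

lemma integral_pair_mult:
  fixes f g :: "_ \<Rightarrow> real"
  assumes "sigma_finite_measure M" "sigma_finite_measure N" "integrable M f" "integrable N g"
  shows "(\<integral>p. f (fst p) * g (snd p) \<partial>(M \<Otimes>\<^sub>M N)) = integral\<^sup>L M f * integral\<^sup>L N g"
proof -
  interpret pair_sigma_finite M N using assms by (simp add: pair_sigma_finite_def)
  show ?thesis
    using integral_fst'[OF integrable_pair_mult[OF assms]] by simp
qed

lemma prod_lessThan_split:
  fixes a b :: "nat \<Rightarrow> 'a::comm_monoid_mult"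
  assumes "n \<le> m"
  shows "(\<Prod>k<m. if k < n then a k else b k) = (\<Prod>k<n. a k) * (\<Prod>k=n..<m. b k)"
  using assms by (subst ivl_disj_un_one(2)[of n m, symmetric], simp)
    (subst prod.union_disjoint, auto)

text \<open>Treats one term of expanded determinants. Each \<open>y\<close> variable is coupled to a
  single \<open>x\<close> variable through \<open>r\<close>, and the remaining \<open>x\<close>
  variables are free, so integrating over \<open>y\<close> first makes everything factor.\<close>

lemma has_bochner_integral_paired_prod:
  fixes h :: "nat \<Rightarrow> 'a \<Rightarrow> 'b \<Rightarrow> real" and w :: "nat \<Rightarrow> 'a \<Rightarrow> real"
  assumes sf: "sigma_finite_measure M" "sigma_finite_measure N"
    and r: "r permutes {..<m}" and nm: "n \<le> m"
    and h: "\<And>k. k < n \<Longrightarrow> integrable (M \<Otimes>\<^sub>M N) (\<lambda>p. h k (fst p) (snd p))"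
    and hx: "\<And>k x. k < n \<Longrightarrow> x \<in> space M \<Longrightarrow> integrable N (h k x)"
    and w: "\<And>k. n \<le> k \<Longrightarrow> k < m \<Longrightarrow> integrable M (w k)"
  shows "has_bochner_integral (PiM {..<m} (\<lambda>_. M) \<Otimes>\<^sub>M PiM {..<n} (\<lambda>_. N))
    (\<lambda>p. (\<Prod>k<n. h k (fst p (r k)) (snd p k)) * (\<Prod>k=n..<m. w k (fst p (r k))))
    ((\<Prod>k<n. \<integral>p. h k (fst p) (snd p) \<partial>(M \<Otimes>\<^sub>M N)) * (\<Prod>k=n..<m. integral\<^sup>L M (w k)))"
proof -
  interpret MN: pair_sigma_finite M N using sf by (simp add: pair_sigma_finite_def)
  interpret PM: product_sigma_finite "\<lambda>_. M" using sf by (simp add: product_sigma_finite_def)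
  interpret PN: product_sigma_finite "\<lambda>_. N" using sf by (simp add: product_sigma_finite_def)
  let ?X = "PiM {..<m} (\<lambda>_. M)" and ?Y = "PiM {..<n} (\<lambda>_. N)"
  interpret XY: pair_sigma_finite ?X ?Y
    using PM.sigma_finite[of "{..<m}"] PN.sigma_finite[of "{..<n}"] by (simp add: pair_sigma_finite_def)
  let ?f = "\<lambda>p. (\<Prod>k<n. h k (fst p (r k)) (snd p k)) * (\<Prod>k=n..<m. w k (fst p (r k)))"
  have rk: "r k < m" if "k < m" for k using permutes_in_image[OF r, of k] that by simp
  note split = prod_lessThan_split[OF nm]
  define r' where "r' = Hilbert_Choice.inv r"
  have r': "r' permutes {..<m}" unfolding r'_def by (rule permutes_inv[OF r])
  \<comment> \<open>Relabelling by the inverse of \<open>r\<close> gives one factor per coordinate,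
    the form that product integrals require.\<close>
  have perm: "(\<Prod>k<m. H k (x (r k))) = (\<Prod>j<m. H (r' j) (x j))" for H :: "nat \<Rightarrow> 'a \<Rightarrow> real" and x
    using prod.permute[OF r, of "\<lambda>j. H (r' j) (x j)"] permutes_inverses(2)[OF r] by (simp add: o_def r'_def)
  have invr: "r' j < m" if "j < m" for j
    using permutes_in_image[OF r', of j] that by simp
  have outer: "integrable ?X (\<lambda>x. \<Prod>k<m. H k (x (r k)))"
     "(\<integral>x. (\<Prod>k<m. H k (x (r k))) \<partial>?X) = (\<Prod>k<m. integral\<^sup>L M (H k))"
    if H: "\<And>k. k < m \<Longrightarrow> integrable M (H k)" for H :: "nat \<Rightarrow> 'a \<Rightarrow> real"
  proof -
    have Hi: "integrable M (H (r' j))" if "j \<in> {..<m}" for j using H invr that by simp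
    show "integrable ?X (\<lambda>x. \<Prod>k<m. H k (x (r k)))"
      unfolding perm by (rule PM.product_integrable_prod[of _ "\<lambda>j. H (r' j)"]) (use Hi in auto)
    have "(\<integral>x. (\<Prod>k<m. H k (x (r k))) \<partial>?X) = (\<Prod>j<m. integral\<^sup>L M (H (r' j)))"
      unfolding perm by (rule PM.product_integral_prod[of _ "\<lambda>j. H (r' j)"]) (use Hi in auto)
    also have "\<dots> = (\<Prod>k<m. integral\<^sup>L M (H k))"
      using prod.permute[OF r', of "\<lambda>k. integral\<^sup>L M (H k)"] by (simp add: o_def)
    finally show "(\<integral>x. (\<Prod>k<m. H k (x (r k))) \<partial>?X) = (\<Prod>k<m. integral\<^sup>L M (H k))" .
  qed
  have fst_m: "(\<lambda>p. fst p (r k)) \<in> (?X \<Otimes>\<^sub>M ?Y) \<rightarrow>\<^sub>M M" if "k < m" for k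
    by (rule measurable_compose[OF measurable_fst measurable_component_singleton]) (use rk that in auto)
  have snd_m: "(\<lambda>p. snd p k) \<in> (?X \<Otimes>\<^sub>M ?Y) \<rightarrow>\<^sub>M N" if "k < n" for k
    by (rule measurable_compose[OF measurable_snd measurable_component_singleton]) (use that in auto)
  have meas: "?f \<in> borel_measurable (?X \<Otimes>\<^sub>M ?Y)"
  proof (intro borel_measurable_times borel_measurable_prod)
    fix k assume "k \<in> {..<n}"
    hence k: "k < n" by simp
    have "(\<lambda>p. (fst p (r k), snd p k)) \<in> (?X \<Otimes>\<^sub>M ?Y) \<rightarrow>\<^sub>M (M \<Otimes>\<^sub>M N)"
      using fst_m[of k] snd_m[of k] k nm by (intro measurable_Pair) auto
    from measurable_compose[OF this borel_measurable_integrable[OF h[OF k]]]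
    show "(\<lambda>p. h k (fst p (r k)) (snd p k)) \<in> borel_measurable (?X \<Otimes>\<^sub>M ?Y)" by simp
  next
    fix k assume "k \<in> {n..<m}"
    then show "(\<lambda>p. w k (fst p (r k))) \<in> borel_measurable (?X \<Otimes>\<^sub>M ?Y)"
      using measurable_compose[OF fst_m[of k] borel_measurable_integrable[OF w[of k]]] by simp
  qed
  have xsp: "x (r k) \<in> space M" if "x \<in> space ?X" "k < m" for x k
    using that rk by (auto simp: space_PiM)
  \<comment> \<open>The integral of the norm has the same product shape as the integral itself, so
    \<open>outer\<close> also supplies the integrability for Fubini.\<close>
  have inner: "integrable ?Y (\<lambda>y. ?f (x, y))"
    "(\<integral>y. ?f (x, y) \<partial>?Y) = (\<Prod>k<m. if k < n then integral\<^sup>L N (h k (x (r k))) else w k (x (r k)))"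
    "(\<integral>y. norm (?f (x, y)) \<partial>?Y) = (\<Prod>k<m. if k < n then (\<integral>y. \<bar>h k (x (r k)) y\<bar> \<partial>N) else \<bar>w k (x (r k))\<bar>)"
    if x: "x \<in> space ?X" for x
  proof -
    have i: "integrable N (h k (x (r k)))" if "k \<in> {..<n}" for k
      using hx[OF _ xsp[OF x]] that nm by auto
    show "integrable ?Y (\<lambda>y. ?f (x, y))"
      using PN.product_integrable_prod[of "{..<n}" "\<lambda>k. h k (x (r k))"] i by simp
    show "(\<integral>y. ?f (x, y) \<partial>?Y) = (\<Prod>k<m. if k < n then integral\<^sup>L N (h k (x (r k))) else w k (x (r k)))"
      using PN.product_integral_prod[of "{..<n}" "\<lambda>k. h k (x (r k))"] i by (simp add: split)
    show "(\<integral>y. norm (?f (x, y)) \<partial>?Y) = (\<Prod>k<m. if k < n then (\<integral>y. \<bar>h k (x (r k)) y\<bar> \<partial>N) else \<bar>w k (x (r k))\<bar>)"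
      using PN.product_integral_prod[of "{..<n}" "\<lambda>k y. \<bar>h k (x (r k)) y\<bar>"] i
      by (simp add: split abs_mult abs_prod)
  qed
  have H1: "integrable M (\<lambda>x. if k < n then integral\<^sup>L N (h k x) else w k x)" if "k < m" for k
    using MN.integrable_fst'[OF h[of k]] w[of k] that by (cases "k < n") auto
  have H2: "integrable M (\<lambda>x. if k < n then (\<integral>y. \<bar>h k x y\<bar> \<partial>N) else \<bar>w k x\<bar>)" if "k < m" for k
    using MN.integrable_fst'[OF integrable_norm[OF h[of k]]] w[of k] that by (cases "k < n") auto
  have int: "integrable (?X \<Otimes>\<^sub>M ?Y) ?f"
  proof (rule XY.Fubini_integrable[OF meas])
    show "integrable ?X (\<lambda>x. \<integral>y. norm (?f (x, y)) \<partial>?Y)"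
      using outer(1)[OF H2] by (subst Bochner_Integration.integrable_cong[OF refl inner(3)]) auto
    show "AE x in ?X. integrable ?Y (\<lambda>y. ?f (x, y))"
      using inner(1) by (intro AE_I2)
  qed
  have "integral\<^sup>L (?X \<Otimes>\<^sub>M ?Y) ?f = (\<integral>x. (\<integral>y. ?f (x, y) \<partial>?Y) \<partial>?X)"
    by (rule XY.integral_fst'[OF int, symmetric])
  also have "\<dots> = (\<integral>x. (\<Prod>k<m. if k < n then integral\<^sup>L N (h k (x (r k))) else w k (x (r k))) \<partial>?X)"
    by (rule Bochner_Integration.integral_cong[OF refl inner(2)])
  also have "\<dots> = (\<Prod>k<m. \<integral>x. (if k < n then integral\<^sup>L N (h k x) else w k x) \<partial>M)"
    by (rule outer(2)[OF H1])
  also have "\<dots> = (\<Prod>k<m. if k < n then (\<integral>p. h k (fst p) (snd p) \<partial>(M \<Otimes>\<^sub>M N)) else integral\<^sup>L M (w k))"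
    using MN.integral_fst'[OF h] by (intro prod.cong refl) auto
  also have "\<dots> = (\<Prod>k<n. \<integral>p. h k (fst p) (snd p) \<partial>(M \<Otimes>\<^sub>M N)) * (\<Prod>k=n..<m. integral\<^sup>L M (w k))"
    by (rule split)
  finally show ?thesis using int by (simp add: has_bochner_integral_iff)
qed

section \<open>Weights and their Cauchy moments\<close>

definition cauchy_moment :: "real measure \<Rightarrow> real measure \<Rightarrow> nat \<Rightarrow> nat \<Rightarrow> real" where
  "cauchy_moment M N i j = (\<integral>p. fst p ^ i * snd p ^ j / (fst p + snd p) \<partial>(M \<Otimes>\<^sub>M N))"

text \<open>
  Cutting the kernel off outside the positive quadrant makes its slices integrable for every
  value of the other variable, not just for almost every one.
\<close>

definition pos_kernel :: "real \<Rightarrow> real \<Rightarrow> real" where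
  "pos_kernel x y = (if 0 < x \<and> 0 < y then 1 / (x + y) else 0)"

lemma measurable_pos_kernel [measurable (raw)]:
  assumes [measurable]: "f \<in> borel_measurable L" "g \<in> borel_measurable L"
  shows "(\<lambda>p. pos_kernel (f p) (g p)) \<in> borel_measurable L"
  unfolding pos_kernel_def by measurable

lemma pos_kernel_bounds: "0 \<le> pos_kernel x y" "\<bar>x * pos_kernel x y\<bar> \<le> 1" "\<bar>y * pos_kernel x y\<bar> \<le> 1"
  by (auto simp: pos_kernel_def)

text \<open>Finite moments do not control \<open>1 / (x + y)\<close> near the origin, so
  \<open>kernel\<close> is a separate assumption.\<close>

locale cauchy_weights =
  fixes M N :: "real measure"
  assumes sets_M [measurable_cong, simp]: "sets M = sets borel"
    and sets_N [measurable_cong, simp]: "sets N = sets borel"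
    and pos_M: "AE x in M. 0 < x"
    and pos_N: "AE y in N. 0 < y"
    and moments_M: "\<And>k::nat. integrable M (\<lambda>x. x ^ k)"
    and moments_N: "\<And>k::nat. integrable N (\<lambda>y. y ^ k)"
    and kernel: "integrable (M \<Otimes>\<^sub>M N) (\<lambda>p. 1 / (fst p + snd p))"

lemma finite_measure_if_integrable_1:
  assumes "integrable M (\<lambda>x. 1 :: real)"
  shows "finite_measure M"
  using assms by (intro finite_measureI) (auto simp: integrable_iff_bounded)

sublocale cauchy_weights \<subseteq> M: finite_measure M
  by (rule finite_measure_if_integrable_1) (use moments_M[of 0] in simp)

sublocale cauchy_weights \<subseteq> N: finite_measure N
  by (rule finite_measure_if_integrable_1) (use moments_N[of 0] in simp)

sublocale cauchy_weights \<subseteq> pair_sigma_finite M N ..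

context cauchy_weights
begin

lemma sigma_finite_weights: "sigma_finite_measure M" "sigma_finite_measure N"
  by unfold_locales

lemma AE_pos: "AE p in M \<Otimes>\<^sub>M N. 0 < fst p \<and> 0 < snd p"
proof (rule AE_pair_measure)
  show "AE x in M. AE y in N. 0 < fst (x, y) \<and> 0 < snd (x, y)"
    using pos_M by eventually_elim (use pos_N in simp)
qed measurable

text \<open>One power of either variable absorbs the kernel and leaves a product of moments. Only
  the case without any power rests on \<open>kernel\<close>.\<close>

lemma integrable_kernel:
  "integrable (M \<Otimes>\<^sub>M N) (\<lambda>p. fst p ^ i * snd p ^ j * pos_kernel (fst p) (snd p))"
proof -
  consider "i = 0" "j = 0" | i' where "i = Suc i'" | j' where "j = Suc j'"
    by (metis not0_implies_Suc)
  then show ?thesis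
  proof cases
    case 1
    show ?thesis unfolding 1
      by (rule Bochner_Integration.integrable_bound[OF kernel]) (auto simp: pos_kernel_def)
  next
    case 2
    have "\<bar>x ^ i * y ^ j * pos_kernel x y\<bar> \<le> \<bar>x ^ i' * y ^ j\<bar>" for x y
      using mult_left_mono[OF pos_kernel_bounds(2)[of x y], of "\<bar>x ^ i' * y ^ j\<bar>"]
      by (simp add: 2 abs_mult mult_ac)
    then show ?thesis
      by (intro Bochner_Integration.integrable_bound[OF integrable_pair_mult[OF sigma_finite_weights
           moments_M[of i'] moments_N[of j]]]) auto
  next
    case 3
    have "\<bar>x ^ i * y ^ j * pos_kernel x y\<bar> \<le> \<bar>x ^ i * y ^ j'\<bar>" for x y
      using mult_left_mono[OF pos_kernel_bounds(3)[of y x], of "\<bar>x ^ i * y ^ j'\<bar>"]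
      by (simp add: 3 abs_mult mult_ac)
    then show ?thesis
      by (intro Bochner_Integration.integrable_bound[OF integrable_pair_mult[OF sigma_finite_weights
           moments_M[of i] moments_N[of j']]]) auto
  qed
qed

text \<open>For fixed \<open>x > 0\<close> the kernel is at most \<open>1 / x\<close>, and for every
  other \<open>x\<close> it is cut off to 0.\<close>

lemma integrable_kernel_slice: "integrable N (\<lambda>y. x ^ i * y ^ j * pos_kernel x y)"
proof (cases "0 < x")
  case True
  have "\<bar>x ^ i * y ^ j * pos_kernel x y\<bar> \<le> \<bar>x ^ i / x * y ^ j\<bar>" for y
  proof -
    have "\<bar>x ^ i / x * y ^ j\<bar> * \<bar>x * pos_kernel x y\<bar> \<le> \<bar>x ^ i / x * y ^ j\<bar> * 1"
      by (intro mult_left_mono pos_kernel_bounds) auto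
    then show ?thesis using True by (simp add: abs_mult field_simps)
  qed
  then show ?thesis
    by (intro Bochner_Integration.integrable_bound[OF integrable_mult_right[OF moments_N[of j], of "x ^ i / x"]]) auto
qed (simp add: pos_kernel_def)

lemma cauchy_moment_AE:
  "AE p in M \<Otimes>\<^sub>M N. fst p ^ i * snd p ^ j / (fst p + snd p) = fst p ^ i * snd p ^ j * pos_kernel (fst p) (snd p)"
  using AE_pos by eventually_elim (simp add: pos_kernel_def)

lemma cauchy_moment_eq:
  "cauchy_moment M N i j = (\<integral>p. fst p ^ i * snd p ^ j * pos_kernel (fst p) (snd p) \<partial>(M \<Otimes>\<^sub>M N))"
  unfolding cauchy_moment_def by (rule integral_cong_AE[OF _ _ cauchy_moment_AE]) measurable

lemma integrable_cauchy_moment: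
  "integrable (M \<Otimes>\<^sub>M N) (\<lambda>p. fst p ^ i * snd p ^ j / (fst p + snd p))"
  by (rule integrable_cong_AE_imp[OF integrable_kernel[of i j]])
     (use cauchy_moment_AE[of i j] in \<open>auto elim: eventually_mono\<close>)

text \<open>The two numerators add up to a multiple of \<open>x + y\<close>, which cancels the
  denominator; the remaining integrand separates.\<close>

lemma cauchy_moment_shift:
  "cauchy_moment M N (Suc i) j + cauchy_moment M N i (Suc j) = integral\<^sup>L M (\<lambda>x. x ^ i) * integral\<^sup>L N (\<lambda>y. y ^ j)"
proof -
  have "cauchy_moment M N (Suc i) j + cauchy_moment M N i (Suc j) =
     (\<integral>p. fst p ^ Suc i * snd p ^ j / (fst p + snd p) + fst p ^ i * snd p ^ Suc j / (fst p + snd p) \<partial>(M \<Otimes>\<^sub>M N))"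
    unfolding cauchy_moment_def
    by (intro Bochner_Integration.integral_add[symmetric] integrable_cauchy_moment)
  also have "\<dots> = (\<integral>p. fst p ^ i * snd p ^ j \<partial>(M \<Otimes>\<^sub>M N))"
  proof (rule integral_cong_AE)
    show "AE p in M \<Otimes>\<^sub>M N. fst p ^ Suc i * snd p ^ j / (fst p + snd p) + fst p ^ i * snd p ^ Suc j / (fst p + snd p)
      = fst p ^ i * snd p ^ j"
      using AE_pos
    proof eventually_elim
      case (elim p)
      have "fst p ^ Suc i * snd p ^ j + fst p ^ i * snd p ^ Suc j = fst p ^ i * snd p ^ j * (fst p + snd p)"
        by (simp add: algebra_simps)
      then show ?case using elim by (simp flip: add_divide_distrib)
    qed
  qed measurable
  also have "\<dots> = integral\<^sup>L M (\<lambda>x. x ^ i) * integral\<^sup>L N (\<lambda>y. y ^ j)"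
    by (rule integral_pair_mult[OF sigma_finite_weights moments_M moments_N])
  finally show ?thesis .
qed

text \<open>Expanding the determinants over \<open>p\<close>, \<open>q\<close>, \<open>r\<close>
  leaves products of single integrals. For each fixed \<open>q\<close> and \<open>r\<close> the sum
  over \<open>p\<close> is the same determinant, which gives the two factorials. The exponents
  \<open>e\<close> and \<open>g\<close> are free so that one of them can be raised.\<close>

lemma andreief:
  fixes e g :: "nat \<Rightarrow> nat"
  assumes nm: "n \<le> m"
  shows "has_bochner_integral (PiM {..<m} (\<lambda>_. M) \<Otimes>\<^sub>M PiM {..<n} (\<lambda>_. N))
    (\<lambda>p. dt m (\<lambda>i j. fst p j ^ e i) * dt n (\<lambda>i k. snd p k ^ g i)
        * dt m (\<lambda>k j. if k < n then pos_kernel (fst p j) (snd p k) else 1))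
    (fact m * fact n * dt m (\<lambda>l i. if l < n then cauchy_moment M N (e i) (g l) else \<integral>x. x ^ e i \<partial>M))"
proof -
  let ?XY = "PiM {..<m} (\<lambda>_. M) \<Otimes>\<^sub>M PiM {..<n} (\<lambda>_. N)"
  let ?B = "\<lambda>l i. if l < n then cauchy_moment M N (e i) (g l) else \<integral>x. x ^ e i \<partial>M"
  let ?Pm = "{p. p permutes {..<m}}" and ?Pn = "{p. p permutes {..<n}}"
  let ?s = "\<lambda>p. of_int (sign p) :: real"
  note split = prod_lessThan_split[OF nm]
  have fac: "has_bochner_integral ?XY
     (\<lambda>z. ?s p * ?s q * ?s r * ((\<Prod>k<n. fst z (r k) ^ e (p (r k)) * snd z k ^ g (q k) * pos_kernel (fst z (r k)) (snd z k))
        * (\<Prod>k=n..<m. fst z (r k) ^ e (p (r k)))))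
     (?s p * ?s q * ?s r * (\<Prod>k<m. ?B (q k) (p (r k))))"
    if "p permutes {..<m}" and q: "q permutes {..<n}" and r: "r permutes {..<m}" for p q r
  proof -
    have "has_bochner_integral ?XY
     (\<lambda>z. (\<Prod>k<n. fst z (r k) ^ e (p (r k)) * snd z k ^ g (q k) * pos_kernel (fst z (r k)) (snd z k))
        * (\<Prod>k=n..<m. fst z (r k) ^ e (p (r k))))
     ((\<Prod>k<n. \<integral>z. fst z ^ e (p (r k)) * snd z ^ g (q k) * pos_kernel (fst z) (snd z) \<partial>(M \<Otimes>\<^sub>M N))
         * (\<Prod>k=n..<m. \<integral>x. x ^ e (p (r k)) \<partial>M))"
      by (rule has_bochner_integral_paired_prod[OF sigma_finite_weights r nm,
            where h = "\<lambda>k x y. x ^ e (p (r k)) * y ^ g (q k) * pos_kernel x y"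
              and w = "\<lambda>k x. x ^ e (p (r k))"])
         (rule integrable_kernel integrable_kernel_slice moments_M)+
    also have "(\<Prod>k<n. \<integral>z. fst z ^ e (p (r k)) * snd z ^ g (q k) * pos_kernel (fst z) (snd z) \<partial>(M \<Otimes>\<^sub>M N))
         * (\<Prod>k=n..<m. \<integral>x. x ^ e (p (r k)) \<partial>M) = (\<Prod>k<m. ?B (q k) (p (r k)))"
      \<comment> \<open>\<open>q\<close> preserves the indices less than \<open>n\<close>, so the
        case distinction inside \<open>?B\<close> is the one at \<open>k\<close>.\<close>
      unfolding split[symmetric] using permutes_in_image[OF q]
      by (intro prod.cong refl) (auto simp: cauchy_moment_eq)
    finally show ?thesis by (rule has_bochner_integral_mult_right)
  qed
  have "has_bochner_integral ?XY
     (\<lambda>z. \<Sum>r\<in>?Pm. \<Sum>q\<in>?Pn. \<Sum>p\<in>?Pm. ?s p * ?s q * ?s r * ((\<Prod>k<n. fst z (r k) ^ e (p (r k)) * snd z k ^ g (q k) * pos_kernel (fst z (r k)) (snd z k))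
        * (\<Prod>k=n..<m. fst z (r k) ^ e (p (r k)))))
     (\<Sum>r\<in>?Pm. \<Sum>q\<in>?Pn. \<Sum>p\<in>?Pm. ?s p * ?s q * ?s r * (\<Prod>k<m. ?B (q k) (p (r k))))"
    by (intro has_bochner_integral_sum fac) auto
  also have "(\<lambda>z. \<Sum>r\<in>?Pm. \<Sum>q\<in>?Pn. \<Sum>p\<in>?Pm. ?s p * ?s q * ?s r * ((\<Prod>k<n. fst z (r k) ^ e (p (r k)) * snd z k ^ g (q k) * pos_kernel (fst z (r k)) (snd z k))
        * (\<Prod>k=n..<m. fst z (r k) ^ e (p (r k))))) = (\<lambda>z. dt m (\<lambda>i j. fst z j ^ e i) * dt n (\<lambda>i k. snd z k ^ g i)
        * dt m (\<lambda>k j. if k < n then pos_kernel (fst z j) (snd z k) else 1))"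
  proof
    fix z :: "(nat \<Rightarrow> real) \<times> (nat \<Rightarrow> real)"
    have t: "?s p * ?s q * ?s r * ((\<Prod>k<n. fst z (r k) ^ e (p (r k)) * snd z k ^ g (q k) * pos_kernel (fst z (r k)) (snd z k))
        * (\<Prod>k=n..<m. fst z (r k) ^ e (p (r k)))) =
      (?s p * (\<Prod>j<m. fst z j ^ e (p j))) * (?s q * (\<Prod>k<n. snd z k ^ g (q k)))
       * (?s r * (\<Prod>k<m. if k < n then pos_kernel (fst z (r k)) (snd z k) else 1))"
      if r: "r permutes {..<m}" for p q r
    proof -
      have "(\<Prod>j<m. fst z j ^ e (p j)) = (\<Prod>k<n. fst z (r k) ^ e (p (r k))) * (\<Prod>k=n..<m. fst z (r k) ^ e (p (r k)))"
        using prod.permute[OF r, of "\<lambda>j. fst z j ^ e (p j)"]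
          split[of "\<lambda>k. fst z (r k) ^ e (p (r k))" "\<lambda>k. fst z (r k) ^ e (p (r k))"] by (simp add: o_def)
      then show ?thesis by (simp add: split prod.distrib)
    qed
    have "dt m (\<lambda>i j. fst z j ^ e i) = (\<Sum>p\<in>?Pm. ?s p * (\<Prod>j<m. fst z j ^ e (p j)))"
      using dt_transpose[of m "\<lambda>i j. fst z j ^ e i"] by (simp add: dt_permutes)
    moreover have "dt n (\<lambda>i j. snd z j ^ g i) = (\<Sum>q\<in>?Pn. ?s q * (\<Prod>j<n. snd z j ^ g (q j)))"
      using dt_transpose[of n "\<lambda>i j. snd z j ^ g i"] by (simp add: dt_permutes)
    moreover have "dt m (\<lambda>k j. if k < n then pos_kernel (fst z j) (snd z k) else 1) =
      (\<Sum>r\<in>?Pm. ?s r * (\<Prod>k<m. if k < n then pos_kernel (fst z (r k)) (snd z k) else 1))"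
      by (simp add: dt_permutes)
    ultimately show "(\<Sum>r\<in>?Pm. \<Sum>q\<in>?Pn. \<Sum>p\<in>?Pm. ?s p * ?s q * ?s r * ((\<Prod>k<n. fst z (r k) ^ e (p (r k)) * snd z k ^ g (q k) * pos_kernel (fst z (r k)) (snd z k))
        * (\<Prod>k=n..<m. fst z (r k) ^ e (p (r k))))) = dt m (\<lambda>i j. fst z j ^ e i) * dt n (\<lambda>i k. snd z k ^ g i)
        * dt m (\<lambda>k j. if k < n then pos_kernel (fst z j) (snd z k) else 1)"
      by (simp add: t sum_distrib_left sum_distrib_right)
  qed
  also have "(\<Sum>r\<in>?Pm. \<Sum>q\<in>?Pn. \<Sum>p\<in>?Pm. ?s p * ?s q * ?s r * (\<Prod>k<m. ?B (q k) (p (r k)))) =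
      (\<Sum>r\<in>?Pm. \<Sum>q\<in>?Pn. dt m ?B)"
  proof (intro sum.cong refl)
    fix r q assume "r \<in> ?Pm" "q \<in> ?Pn"
    hence r: "r permutes {..<m}" and q: "q permutes {..<n}" by auto
    have qm: "q permutes {..<m}" by (rule permutes_subset[OF q]) (use nm in auto)
    \<comment> \<open>The permutation \<open>r\<close> is absorbed into \<open>p\<close>, sign
      included; \<open>q\<close> then permutes the rows of \<open>?B\<close>, and its sign appears
      twice and cancels.\<close>
    have "(\<Sum>p\<in>?Pm. ?s p * ?s q * ?s r * (\<Prod>k<m. ?B (q k) (p (r k)))) =
       ?s q * (\<Sum>p\<in>?Pm. ?s (p \<circ> r) * (\<Prod>k<m. ?B (q k) ((p \<circ> r) k)))"
      unfolding sum_distrib_left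
    proof (intro sum.cong refl)
      fix p assume "p \<in> ?Pm"
      hence "sign (p \<circ> r) = sign p * sign r"
        using r by (intro sign_compose) (auto simp: permutation_permutes)
      then show "?s p * ?s q * ?s r * (\<Prod>k<m. ?B (q k) (p (r k))) =
         ?s q * (?s (p \<circ> r) * (\<Prod>k<m. ?B (q k) ((p \<circ> r) k)))"
        unfolding o_apply by simp
    qed
    also have "(\<Sum>p\<in>?Pm. ?s (p \<circ> r) * (\<Prod>k<m. ?B (q k) ((p \<circ> r) k))) =
        (\<Sum>p\<in>?Pm. ?s p * (\<Prod>k<m. ?B (q k) (p k)))"
      by (rule sum_permutations_compose_right[OF r, symmetric])
    also have "\<dots> = dt m (\<lambda>k. ?B (q k))" by (simp add: dt_permutes)
    also have "\<dots> = ?s q * dt m ?B" by (rule dt_permute_rows[OF qm])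
    also have "?s q * (?s q * dt m ?B) = dt m ?B"
      by (simp add: sign_def)
    finally show "(\<Sum>p\<in>?Pm. ?s p * ?s q * ?s r * (\<Prod>k<m. ?B (q k) (p (r k)))) = dt m ?B" .
  qed
  also have "\<dots> = fact m * fact n * dt m ?B"
    by (simp add: card_permutations[of _ m] card_permutations[of _ n])
  finally show ?thesis .
qed

lemma AE_PiM_pos:
  fixes m n :: nat
  shows "AE p in PiM {..<m} (\<lambda>_. M) \<Otimes>\<^sub>M PiM {..<n} (\<lambda>_. N). (\<forall>j<m. 0 < fst p j) \<and> (\<forall>k<n. 0 < snd p k)"
proof -
  interpret PM: product_sigma_finite "\<lambda>_. M" using sigma_finite_weights by (simp add: product_sigma_finite_def)
  interpret PN: product_sigma_finite "\<lambda>_. N" using sigma_finite_weights by (simp add: product_sigma_finite_def)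
  interpret XY: pair_sigma_finite "PiM {..<m} (\<lambda>_. M)" "PiM {..<n} (\<lambda>_. N)"
    using PM.sigma_finite[of "{..<m}"] PN.sigma_finite[of "{..<n}"] by (simp add: pair_sigma_finite_def)
  have a: "AE x in PiM {..<m} (\<lambda>_. M). \<forall>j\<in>{..<m}. 0 < x j"
    by (rule AE_PiM_all) (use sigma_finite_weights pos_M in auto)
  have b: "AE y in PiM {..<n} (\<lambda>_. N). \<forall>j\<in>{..<n}. 0 < y j"
    by (rule AE_PiM_all) (use sigma_finite_weights pos_N in auto)
  have "AE p in PiM {..<m} (\<lambda>_. M) \<Otimes>\<^sub>M PiM {..<n} (\<lambda>_. N). (\<forall>j\<in>{..<m}. 0 < fst p j) \<and> (\<forall>k\<in>{..<n}. 0 < snd p k)"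
  proof (rule XY.AE_pair_measure)
    show "AE x in PiM {..<m} (\<lambda>_. M). AE y in PiM {..<n} (\<lambda>_. N). (\<forall>j\<in>{..<m}. 0 < fst (x, y) j) \<and> (\<forall>k\<in>{..<n}. 0 < snd (x, y) k)"
      using a by eventually_elim (use b in \<open>auto elim: eventually_mono\<close>)
  qed measurable
  then show ?thesis by (auto elim: eventually_mono)
qed

lemma measurable_ckern:
  "(\<lambda>p. ckern m n (fst p) (snd p)) \<in> borel_measurable (PiM {..<m} (\<lambda>_. M) \<Otimes>\<^sub>M PiM {..<n} (\<lambda>_. N))"
  unfolding ckern_def vdm_def by measurable

text \<open>The cut-off kernel and \<open>1 / (x + y)\<close> agree almost everywhere, so each
  multiple integral comes down to the pointwise identity \<open>eq\<close>, demanded where no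
  denominator vanishes.\<close>

lemma integral_ckern:
  assumes nm: "n \<le> m"
    and f: "(\<lambda>p. f (fst p) (snd p)) \<in> borel_measurable (PiM {..<m} (\<lambda>_. M) \<Otimes>\<^sub>M PiM {..<n} (\<lambda>_. N))"
    and eq: "\<And>x y. (\<And>j k. j < m \<Longrightarrow> k < n \<Longrightarrow> x j + y k \<noteq> 0) \<Longrightarrow> ckern m n x y * f x y =
      dt m (\<lambda>i j. x j ^ e i) * dt n (\<lambda>i k. y k ^ g i) * dt m (\<lambda>k j. if k < n then 1 / (x j + y k) else 1)"
  shows "(\<integral>p. ckern m n (fst p) (snd p) * f (fst p) (snd p) \<partial>(PiM {..<m} (\<lambda>_. M) \<Otimes>\<^sub>M PiM {..<n} (\<lambda>_. N))) =
    fact m * fact n * dt m (\<lambda>l i. if l < n then cauchy_moment M N (e i) (g l) else \<integral>x. x ^ e i \<partial>M)"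
proof -
  note A = andreief[OF nm, of e g, unfolded has_bochner_integral_iff]
  show ?thesis unfolding A[THEN conjunct2, symmetric]
  proof (rule integral_cong_AE)
    show "AE p in PiM {..<m} (\<lambda>_. M) \<Otimes>\<^sub>M PiM {..<n} (\<lambda>_. N). ckern m n (fst p) (snd p) * f (fst p) (snd p) =
       dt m (\<lambda>i j. fst p j ^ e i) * dt n (\<lambda>i k. snd p k ^ g i)
        * dt m (\<lambda>k j. if k < n then pos_kernel (fst p j) (snd p k) else 1)"
      using AE_PiM_pos[of m n]
    proof eventually_elim
      case (elim p)
      have "fst p j + snd p k \<noteq> 0" if "j < m" "k < n" for j k
        using elim that by (smt (verit))
      moreover have "dt m (\<lambda>k j. if k < n then pos_kernel (fst p j) (snd p k) else 1) =
         dt m (\<lambda>k j. if k < n then 1 / (fst p j + snd p k) else 1)"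
        using elim by (intro dt_cong) (simp add: pos_kernel_def)
      ultimately show ?case using eq[of "fst p" "snd p"] by simp
    qed
  qed (use A f measurable_ckern in auto)
qed

end

section \<open>The multiple integrals as bordered and shifted minors\<close>

context cauchy_weights
begin

text \<open>Of each squared Vandermonde factor in \<open>ckern\<close>, one copy is part of the
  Cauchy determinant and the other is the determinant of powers.\<close>

lemma integral_ckern_square:
  "(\<integral>p. ckern n n (fst p) (snd p) \<partial>(PiM {..<n} (\<lambda>_. M) \<Otimes>\<^sub>M PiM {..<n} (\<lambda>_. N))) =
    fact n * fact n * dt n (\<lambda>l i. cauchy_moment M N i l)"
proof -
  have "ckern n n x y * 1 = dt n (\<lambda>i j. x j ^ i) * dt n (\<lambda>i k. y k ^ i)
      * dt n (\<lambda>k j. if k < n then 1 / (x j + y k) else 1)"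
    if "\<And>j k. j < n \<Longrightarrow> k < n \<Longrightarrow> x j + y k \<noteq> 0" for x y
  proof -
    have "dt n (\<lambda>k j. if k < n then 1 / (x j + y k) else 1) = dt n (\<lambda>k j. 1 / (x j + y k))"
      by (rule dt_cong) simp
    then show ?thesis using cauchy_dt[OF that]
      by (simp add: vandermonde_dt ckern_def power2_eq_square)
  qed
  from integral_ckern[of n n "\<lambda>x y. 1" "\<lambda>i. i" "\<lambda>i. i", OF _ _ this]
  have "(\<integral>p. ckern n n (fst p) (snd p) * 1 \<partial>(PiM {..<n} (\<lambda>_. M) \<Otimes>\<^sub>M PiM {..<n} (\<lambda>_. N))) =
    fact n * fact n * dt n (\<lambda>l i. if l < n then cauchy_moment M N i l else \<integral>x. x ^ i \<partial>M)" by simp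
  also have "dt n (\<lambda>l i. if l < n then cauchy_moment M N i l else \<integral>x. x ^ i \<partial>M) =
      dt n (\<lambda>l i. cauchy_moment M N i l)"
    by (rule dt_cong) simp
  finally show ?thesis by simp
qed

lemma integral_ckern_Suc:
  "(\<integral>p. ckern (Suc n) n (fst p) (snd p) \<partial>(PiM {..<Suc n} (\<lambda>_. M) \<Otimes>\<^sub>M PiM {..<n} (\<lambda>_. N))) =
    fact (Suc n) * fact n * dt (Suc n) (\<lambda>l i. if l < n then cauchy_moment M N i l else \<integral>x. x ^ i \<partial>M)"
proof -
  have "ckern (Suc n) n x y * 1 = dt (Suc n) (\<lambda>i j. x j ^ i) * dt n (\<lambda>i k. y k ^ i)
      * dt (Suc n) (\<lambda>k j. if k < n then 1 / (x j + y k) else 1)"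
    if "\<And>j k. j < Suc n \<Longrightarrow> k < n \<Longrightarrow> x j + y k \<noteq> 0" for x y
    using cauchy_dt_bordered[OF that] by (simp add: vandermonde_dt ckern_def power2_eq_square)
  from integral_ckern[of n "Suc n" "\<lambda>x y. 1" "\<lambda>i. i" "\<lambda>i. i", OF _ _ this] show ?thesis
    by simp
qed

text \<open>The extra factor is absorbed by the determinant of powers of \<open>y\<close>, whose top
  exponent rises by one; this shifts the last row of moments.\<close>

lemma integral_ckern_sum_y:
  "(\<integral>p. ckern (Suc n) (Suc n) (fst p) (snd p) * (\<Sum>j<Suc n. snd p j)
      \<partial>(PiM {..<Suc n} (\<lambda>_. M) \<Otimes>\<^sub>M PiM {..<Suc n} (\<lambda>_. N))) =
    fact (Suc n) * fact (Suc n) * dt (Suc n) (\<lambda>l i. if l < n then cauchy_moment M N i l else cauchy_moment M N i (Suc n))"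
proof -
  let ?g = "\<lambda>i. if i = n then Suc n else i"
  have "ckern (Suc n) (Suc n) x y * (\<Sum>j<Suc n. y j) = dt (Suc n) (\<lambda>i j. x j ^ i) * dt (Suc n) (\<lambda>i k. y k ^ ?g i)
      * dt (Suc n) (\<lambda>k j. if k < Suc n then 1 / (x j + y k) else 1)"
    if "\<And>j k. j < Suc n \<Longrightarrow> k < Suc n \<Longrightarrow> x j + y k \<noteq> 0" for x y
  proof -
    have "dt (Suc n) (\<lambda>k j. if k < Suc n then 1 / (x j + y k) else 1) = dt (Suc n) (\<lambda>k j. 1 / (x j + y k))"
      by (rule dt_cong) simp
    also note cauchy_dt[OF that]
    finally show ?thesis unfolding vandermonde_dt vandermonde_sum_dt
      by (simp add: ckern_def power2_eq_square)
  qed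
  from integral_ckern[of "Suc n" "Suc n" "\<lambda>x y. \<Sum>j<Suc n. y j" "\<lambda>i. i" ?g, OF _ _ this]
  have "(\<integral>p. ckern (Suc n) (Suc n) (fst p) (snd p) * (\<Sum>j<Suc n. snd p j)
      \<partial>(PiM {..<Suc n} (\<lambda>_. M) \<Otimes>\<^sub>M PiM {..<Suc n} (\<lambda>_. N))) =
    fact (Suc n) * fact (Suc n) * dt (Suc n) (\<lambda>l i. if l < Suc n then cauchy_moment M N i (?g l) else \<integral>x. x ^ i \<partial>M)"
    by simp
  also have "dt (Suc n) (\<lambda>l i. if l < Suc n then cauchy_moment M N i (?g l) else \<integral>x. x ^ i \<partial>M) =
      dt (Suc n) (\<lambda>l i. if l < n then cauchy_moment M N i l else cauchy_moment M N i (Suc n))"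
    by (rule dt_cong) auto
  finally show ?thesis .
qed

end

text \<open>The kernel is symmetric under exchange of the two sets of variables. This carries
  results on \<open>sigma_hat\<close> and \<open>xi_hat\<close> over to \<open>sigma\<close> and
  \<open>xi\<close>.\<close>

lemma cint_swap:
  assumes "sigma_finite_measure (\<mu>1 t)" "sigma_finite_measure (\<mu>2 t)"
    and "sets (\<mu>1 t) = sets borel" "sets (\<mu>2 t) = sets borel"
    and f: "(\<lambda>p. f (fst p) (snd p)) \<in> borel_measurable (PiM {..<m} (\<lambda>_. \<mu>1 t) \<Otimes>\<^sub>M PiM {..<n} (\<lambda>_. \<mu>2 t))"
  shows "cint n m \<mu>2 \<mu>1 (\<lambda>y x. f x y) t = cint m n \<mu>1 \<mu>2 f t"
proof -
  interpret PM: product_sigma_finite "\<lambda>_. \<mu>1 t" using assms by (simp add: product_sigma_finite_def)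
  interpret PN: product_sigma_finite "\<lambda>_. \<mu>2 t" using assms by (simp add: product_sigma_finite_def)
  let ?X = "PiM {..<m} (\<lambda>_. \<mu>1 t)" and ?Y = "PiM {..<n} (\<lambda>_. \<mu>2 t)"
  interpret XY: pair_sigma_finite ?X ?Y
    using PM.sigma_finite[of "{..<m}"] PN.sigma_finite[of "{..<n}"] by (simp add: pair_sigma_finite_def)
  note [measurable_cong] = assms(3,4)
  have c: "(\<lambda>p. ckern m n (fst p) (snd p)) \<in> borel_measurable (?X \<Otimes>\<^sub>M ?Y)"
    unfolding ckern_def vdm_def by measurable
  have sw: "ckern n m y x = ckern m n x y" for x y
    by (simp add: ckern_def mult.commute add.commute prod.swap[of _ "{..<m}" "{..<n}"])
  have "(\<integral>(y, x). ckern m n x y * f x y \<partial>(?Y \<Otimes>\<^sub>M ?X)) =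
      (\<integral>p. ckern m n (fst p) (snd p) * f (fst p) (snd p) \<partial>(?X \<Otimes>\<^sub>M ?Y))"
    using XY.integral_product_swap[OF borel_measurable_times[OF c f]] by simp
  then show ?thesis by (simp add: cint_def sw case_prod_beta' mult.commute)
qed

lemma cauchy_moment_swap:
  assumes "sigma_finite_measure M" "sigma_finite_measure N" "sets M = sets borel" "sets N = sets borel"
  shows "cauchy_moment N M j i = cauchy_moment M N i j"
proof -
  interpret pair_sigma_finite M N using assms by (simp add: pair_sigma_finite_def)
  note [measurable_cong] = assms(3,4)
  have "(\<lambda>p. fst p ^ i * snd p ^ j / (fst p + snd p)) \<in> borel_measurable (M \<Otimes>\<^sub>M N)" by measurable
  from integral_product_swap[OF this] show ?thesis
    by (simp add: cauchy_moment_def case_prod_beta' mult.commute add.commute)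
qed

text \<open>The Bochner integral of a non-integrable function is \<open>0\<close>.\<close>

lemma integrable_cauchy_kernel_if_tau_nonzero:
  assumes sf: "sigma_finite_measure (\<mu>1 t)" "sigma_finite_measure (\<mu>2 t)"
    and sets: "sets (\<mu>1 t) = sets borel" "sets (\<mu>2 t) = sets borel"
    and "tau \<mu>1 \<mu>2 1 t \<noteq> 0"
  shows "integrable (\<mu>1 t \<Otimes>\<^sub>M \<mu>2 t) (\<lambda>p. 1 / (fst p + snd p))"
proof -
  interpret PM: product_sigma_finite "\<lambda>_. \<mu>1 t" using sf by (simp add: product_sigma_finite_def)
  interpret PN: product_sigma_finite "\<lambda>_. \<mu>2 t" using sf by (simp add: product_sigma_finite_def)
  note [measurable_cong] = sets
  let ?X = "PiM {0::nat} (\<lambda>_. \<mu>1 t)" and ?Y = "PiM {0::nat} (\<lambda>_. \<mu>2 t)"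
  \<comment> \<open>The first tau integrates over products with a single coordinate; evaluation at 0
    identifies these with the measures themselves.\<close>
  have d: "distr ?X (\<mu>1 t) (\<lambda>x. x 0) = \<mu>1 t" "distr ?Y (\<mu>2 t) (\<lambda>x. x 0) = \<mu>2 t"
    by (rule PM.distr_singleton PN.distr_singleton)+
  have "\<mu>1 t \<Otimes>\<^sub>M \<mu>2 t = distr (?X \<Otimes>\<^sub>M ?Y) (\<mu>1 t \<Otimes>\<^sub>M \<mu>2 t) (\<lambda>(x, y). (x 0, y 0))"
    using pair_measure_distr[of "\<lambda>x. x 0" ?X "\<mu>1 t" "\<lambda>x. x 0" ?Y "\<mu>2 t"]
    by (simp add: d sf)
  moreover have "integrable (distr (?X \<Otimes>\<^sub>M ?Y) (\<mu>1 t \<Otimes>\<^sub>M \<mu>2 t) (\<lambda>(x, y). (x 0, y 0))) (\<lambda>p. 1 / (fst p + snd p))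
      \<longleftrightarrow> integrable (?X \<Otimes>\<^sub>M ?Y) (\<lambda>p. 1 / (fst (case p of (x, y) \<Rightarrow> (x 0, y 0)) + snd (case p of (x, y) \<Rightarrow> (x 0, y 0))))"
    by (rule integrable_distr_eq) measurable
  moreover have "integrable (?X \<Otimes>\<^sub>M ?Y) (\<lambda>p. 1 / (fst p 0 + snd p 0))"
    using assms(5) not_integrable_integral_eq
    by (fastforce simp: tau_def cint_def ckern_def vdm_def lessThan_Suc)
  ultimately show ?thesis
    by (simp add: case_prod_beta')
qed

section \<open>Evolution of the integrals\<close>

lemma cauchy_weights_swap:
  assumes "cauchy_weights M N"
  shows "cauchy_weights N M"
proof -
  interpret cauchy_weights M N by fact
  have "(\<lambda>(y, x). 1 / (x + y :: real)) = (\<lambda>p. 1 / (fst p + snd p))"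
    by (auto simp: add.commute)
  then have "integrable (N \<Otimes>\<^sub>M M) (\<lambda>p. 1 / (fst p + snd p))"
    using integrable_product_swap[OF kernel] by simp
  then show ?thesis
    by (intro cauchy_weights.intro) (auto intro: pos_M pos_N moments_M moments_N)
qed

text \<open>
  Integrates \<open>h u \<le> e\<^sup>h\<^sup>u - 1 \<le> h u e\<^sup>h\<^sup>u\<close> with \<open>u = x + y\<close>. Both bounds have the same derivative at
  \<open>h = 0\<close>, which replaces differentiation under the integral sign.
\<close>

lemma cauchy_moment_tilt_bounds:
  assumes "cauchy_weights M N" "cauchy_weights M' N'"
    and M': "M' = density M (\<lambda>x. ennreal (exp (h * x)))"
    and N': "N' = density N (\<lambda>y. ennreal (exp (h * y)))"
  shows "h * ((\<integral>x. x ^ i \<partial>M) * (\<integral>y. y ^ j \<partial>N)) \<le> cauchy_moment M' N' i j - cauchy_moment M N i j"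
    and "cauchy_moment M' N' i j - cauchy_moment M N i j \<le> h * ((\<integral>x. x ^ i \<partial>M') * (\<integral>y. y ^ j \<partial>N'))"
proof -
  interpret cauchy_weights M N by fact
  interpret W': cauchy_weights M' N' by fact
  let ?E = "\<lambda>p. exp (h * (fst p + snd p))"
  let ?k = "\<lambda>p. fst p ^ i * snd p ^ j / (fst p + snd p)" and ?m = "\<lambda>p. fst p ^ i * snd p ^ j"
  have "M' \<Otimes>\<^sub>M N' = density (M \<Otimes>\<^sub>M N) (\<lambda>(x, y). ennreal (exp (h * x)) * ennreal (exp (h * y)))"
    unfolding M' N'
    by (rule pair_measure_density) (use W'.sigma_finite_weights(2) sigma_finite_weights in \<open>simp_all add: N'\<close>)
  also have "(\<lambda>(x, y). ennreal (exp (h * x)) * ennreal (exp (h * y))) = (\<lambda>p. ennreal (?E p))"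
    by (auto simp: distrib_left exp_add ennreal_mult)
  finally have dens: "M' \<Otimes>\<^sub>M N' = density (M \<Otimes>\<^sub>M N) (\<lambda>p. ennreal (?E p))" .
  have [measurable]: "?k \<in> borel_measurable (M \<Otimes>\<^sub>M N)" "?m \<in> borel_measurable (M \<Otimes>\<^sub>M N)"
    "?E \<in> borel_measurable (M \<Otimes>\<^sub>M N)"
    by measurable
  have tilt: "integrable (M \<Otimes>\<^sub>M N) (\<lambda>p. ?E p * f p)" "(\<integral>p. ?E p * f p \<partial>(M \<Otimes>\<^sub>M N)) = integral\<^sup>L (M' \<Otimes>\<^sub>M N') f"
    if "integrable (M' \<Otimes>\<^sub>M N') f" "f \<in> borel_measurable (M \<Otimes>\<^sub>M N)" for f :: "real \<times> real \<Rightarrow> real"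
    using that unfolding dens by (simp_all add: integrable_real_density integral_real_density)
  note k = integrable_cauchy_moment[of i j] and k' = tilt[OF W'.integrable_cauchy_moment[of i j]]
  note m = integrable_pair_mult[OF sigma_finite_weights moments_M[of i] moments_N[of j]]
  note m' = tilt[OF integrable_pair_mult[OF W'.sigma_finite_weights W'.moments_M[of i] W'.moments_N[of j]]]
  have diff: "cauchy_moment M' N' i j - cauchy_moment M N i j = (\<integral>p. ?E p * ?k p - ?k p \<partial>(M \<Otimes>\<^sub>M N))"
    using k k' by (simp add: cauchy_moment_def)
  have bounds: "AE p in M \<Otimes>\<^sub>M N. h * ?m p \<le> ?E p * ?k p - ?k p \<and> ?E p * ?k p - ?k p \<le> h * (?E p * ?m p)"
    using AE_pos
  proof eventually_elim
    case (elim p)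
    define u where "u = fst p + snd p"
    have u: "u > 0" using elim by (simp add: u_def)
    define v where "v = ?k p"
    have mv: "?m p = u * v" and v: "0 \<le> v" using elim by (auto simp: u_def v_def)
    have e1: "h * u \<le> exp (h * u) - 1" using exp_ge_add_one_self[of "h * u"] by linarith
    have "exp (h * u) * (1 - h * u) \<le> exp (h * u) * exp (- (h * u))"
      using exp_ge_add_one_self[of "- (h * u)"] by (intro mult_left_mono) auto
    hence e2: "exp (h * u) - 1 \<le> h * u * exp (h * u)"
      by (simp add: exp_minus algebra_simps)
    have "h * (u * v) \<le> exp (h * u) * v - v" "exp (h * u) * v - v \<le> h * (exp (h * u) * (u * v))"
      using mult_right_mono[OF e1 v] mult_right_mono[OF e2 v] by (simp_all add: algebra_simps)
    then show ?case
      unfolding v_def[symmetric] unfolding mv u_def[symmetric] by blast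
  qed
  have "h * ((\<integral>x. x ^ i \<partial>M) * (\<integral>y. y ^ j \<partial>N)) = (\<integral>p. h * ?m p \<partial>(M \<Otimes>\<^sub>M N))"
    using integral_pair_mult[OF sigma_finite_weights moments_M[of i] moments_N[of j]] by simp
  also have "\<dots> \<le> (\<integral>p. ?E p * ?k p - ?k p \<partial>(M \<Otimes>\<^sub>M N))"
    by (rule integral_mono_AE) (use m k k'(1) bounds in \<open>auto elim: eventually_mono\<close>)
  finally show "h * ((\<integral>x. x ^ i \<partial>M) * (\<integral>y. y ^ j \<partial>N)) \<le> cauchy_moment M' N' i j - cauchy_moment M N i j"
    unfolding diff .
  have "(\<integral>p. ?E p * ?k p - ?k p \<partial>(M \<Otimes>\<^sub>M N)) \<le> (\<integral>p. h * (?E p * ?m p) \<partial>(M \<Otimes>\<^sub>M N))"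
    by (rule integral_mono_AE) (use m'(1) k k'(1) bounds in \<open>auto elim: eventually_mono\<close>)
  also have "\<dots> = h * ((\<integral>x. x ^ i \<partial>M') * (\<integral>y. y ^ j \<partial>N'))"
    using m'(2) integral_pair_mult[OF W'.sigma_finite_weights W'.moments_M[of i] W'.moments_N[of j]] by simp
  finally show "cauchy_moment M' N' i j - cauchy_moment M N i j \<le> h * ((\<integral>x. x ^ i \<partial>M') * (\<integral>y. y ^ j \<partial>N'))"
    unfolding diff .
qed

text \<open>The bounds trap \<open>J s - J t - (s - t) * a t\<close> between 0 and
  \<open>(s - t) * (a s - a t)\<close> for either sign of \<open>s - t\<close>, and continuity of
  \<open>a\<close> finishes.\<close>

lemma has_real_derivative_sandwich:
  fixes J a :: "real \<Rightarrow> real"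
  assumes T: "open T" "t \<in> T" and a: "isCont a t"
    and lo: "\<And>s. s \<in> T \<Longrightarrow> (s - t) * a t \<le> J s - J t"
    and hi: "\<And>s. s \<in> T \<Longrightarrow> J s - J t \<le> (s - t) * a s"
  shows "(J has_real_derivative a t) (at t)"
proof -
  have "((\<lambda>s. (J s - J t) / (s - t) - a t) \<longlongrightarrow> 0) (at t)"
  proof (rule tendsto_0_le[where f = "\<lambda>s. a s - a t" and K = 1])
    show "((\<lambda>s. a s - a t) \<longlongrightarrow> 0) (at t)"
      using a by (simp add: isCont_def LIM_zero)
    have "eventually (\<lambda>s. s \<in> T) (at t)" using T by (auto simp: eventually_at_topological)
    moreover have "eventually (\<lambda>s. s \<noteq> t) (at t)" by (simp add: eventually_at_filter)
    ultimately show "\<forall>\<^sub>F s in at t. norm ((J s - J t) / (s - t) - a t) \<le> norm (a s - a t) * 1"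
    proof eventually_elim
      case (elim s)
      have "\<bar>J s - J t - (s - t) * a t\<bar> \<le> \<bar>(s - t) * (a s - a t)\<bar>"
        using lo[of s] hi[of s] elim by (simp add: right_diff_distrib)
      also have "J s - J t - (s - t) * a t = (s - t) * ((J s - J t) / (s - t) - a t)"
        using elim by (simp add: field_simps)
      finally have "\<bar>s - t\<bar> * \<bar>(J s - J t) / (s - t) - a t\<bar> \<le> \<bar>s - t\<bar> * \<bar>a s - a t\<bar>"
        by (simp only: abs_mult)
      then show ?case using elim by (simp add: mult_le_cancel_left_pos)
    qed
  qed
  then show ?thesis by (simp add: has_field_derivative_iff LIM_zero_iff)
qed

text \<open>Rows of \<open>G\<close> carry the exponents of \<open>y\<close>. Hence
  \<open>sigma_hat\<close> borders it by a row of \<open>x\<close> moments, and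
  \<open>xi_hat\<close> replaces its last row by the following one.\<close>

lemma cint_elim:
  assumes "cauchy_weights (\<mu>1 t) (\<mu>2 t)" and nz: "\<And>n. tau \<mu>1 \<mu>2 n t \<noteq> 0"
  defines "G \<equiv> \<lambda>l i. cauchy_moment (\<mu>1 t) (\<mu>2 t) i l"
  shows tau_elim: "tau \<mu>1 \<mu>2 n t = (\<Prod>k<n. elim G k k k)"
    and elim_pivot_nonzero: "elim G n n n \<noteq> 0"
    and sigma_hat_elim: "sigma_hat \<mu>1 \<mu>2 n t = tau \<mu>1 \<mu>2 n t * elim_row G (\<lambda>i. \<integral>x. x ^ i \<partial>\<mu>1 t) n n"
    and xi_hat_elim: "xi_hat \<mu>1 \<mu>2 n t / tau \<mu>1 \<mu>2 n t = elim_coeff G (G n) n"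
proof -
  interpret cauchy_weights "\<mu>1 t" "\<mu>2 t" by fact
  have tau_dt: "tau \<mu>1 \<mu>2 n t = dt n G" for n
    unfolding tau_def cint_def G_def using integral_ckern_square[of n] by simp
  have tau_Suc: "tau \<mu>1 \<mu>2 (Suc n) t = (\<Prod>k<Suc n. elim G k k k)"
    if "\<And>k. k < n \<Longrightarrow> elim G k k k \<noteq> 0" for n
  proof -
    have "dt (Suc n) G = dt (Suc n) (\<lambda>l i. if l < n then G l i else G n i)"
      by (rule dt_cong) (auto simp: less_Suc_eq)
    then show ?thesis using dt_elim_row[of n G "G n"] that by (simp add: tau_dt elim_row_self[of G])
  qed
  \<comment> \<open>The factorization of tau at \<open>Suc n\<close> uses only the pivots before
    \<open>n\<close>, and its nonvanishing then forces pivot \<open>n\<close> to be nonzero.\<close>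
  have piv: "elim G n n n \<noteq> 0" for n
  proof (induction n rule: less_induct)
    case (less n)
    from tau_Suc[OF less] nz[of "Suc n"] show ?case by auto
  qed
  show "elim G n n n \<noteq> 0" by (rule piv)
  have tau: "tau \<mu>1 \<mu>2 n t = (\<Prod>k<n. elim G k k k)" for n
  proof (cases n)
    case 0
    then show ?thesis by (simp add: tau_dt dt_def)
  next
    case (Suc m)
    then show ?thesis using tau_Suc[of m] piv by simp
  qed
  show "tau \<mu>1 \<mu>2 n t = (\<Prod>k<n. elim G k k k)" by (rule tau)
  have "sigma_hat \<mu>1 \<mu>2 n t = dt (Suc n) (\<lambda>l i. if l < n then G l i else \<integral>x. x ^ i \<partial>\<mu>1 t)"
    unfolding sigma_hat_def cint_def G_def using integral_ckern_Suc[of n] by simp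
  then show "sigma_hat \<mu>1 \<mu>2 n t = tau \<mu>1 \<mu>2 n t * elim_row G (\<lambda>i. \<integral>x. x ^ i \<partial>\<mu>1 t) n n"
    using dt_elim_row[of n G] piv by (simp add: tau)
  show "xi_hat \<mu>1 \<mu>2 n t / tau \<mu>1 \<mu>2 n t = elim_coeff G (G n) n"
  proof (cases n)
    \<comment> \<open>An empty sum on the left meets the value 0 of \<open>elim_coeff\<close> at
      0.\<close>
    case 0
    then show ?thesis by (simp add: xi_hat_def cint_def)
  next
    case (Suc m)
    have "xi_hat \<mu>1 \<mu>2 n t = dt (Suc m) (\<lambda>l i. if l < m then G l i else G (Suc m) i)"
      unfolding xi_hat_def cint_def G_def Suc using integral_ckern_sum_y[of m]
      by (simp only:) simp
    also have "\<dots> = tau \<mu>1 \<mu>2 m t * elim_row G (G (Suc m)) m m"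
      using dt_elim_row[of m G] piv by (simp add: tau)
    finally show ?thesis using piv[of m] nz[of m] by (simp add: Suc tau)
  qed
qed

lemma cint_functions_swap:
  assumes "cauchy_weights (\<mu>1 t) (\<mu>2 t)"
  shows "tau \<mu>2 \<mu>1 n t = tau \<mu>1 \<mu>2 n t" "sigma_hat \<mu>2 \<mu>1 n t = sigma \<mu>1 \<mu>2 n t"
    "xi_hat \<mu>2 \<mu>1 n t = xi \<mu>1 \<mu>2 n t"
proof -
  interpret cauchy_weights "\<mu>1 t" "\<mu>2 t" by fact
  note sw = cint_swap[of \<mu>1 t \<mu>2, OF sigma_finite_weights sets_M sets_N]
  show "tau \<mu>2 \<mu>1 n t = tau \<mu>1 \<mu>2 n t"
    unfolding tau_def by (rule sw) simp
  show "sigma_hat \<mu>2 \<mu>1 n t = sigma \<mu>1 \<mu>2 n t"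
    unfolding sigma_def sigma_hat_def by (rule sw) simp
  show "xi_hat \<mu>2 \<mu>1 n t = xi \<mu>1 \<mu>2 n t"
    unfolding xi_def xi_hat_def by (rule sw) measurable
qed

text \<open>The evolution of the measures enters in integrated form, as an exponential density
  between any two times.\<close>

theorem theorem3p4:
  fixes \<mu>1 \<mu>2 :: "real \<Rightarrow> real measure" and T :: "real set"
  assumes T_open: "open T"
    and sets1: "\<forall>t\<in>T. sets (\<mu>1 t) = sets borel"
    and sets2: "\<forall>t\<in>T. sets (\<mu>2 t) = sets borel"
    and pos1: "\<forall>t\<in>T. AE x in \<mu>1 t. 0 < x"
    and pos2: "\<forall>t\<in>T. AE y in \<mu>2 t. 0 < y"
    and evol1: "\<forall>s\<in>T. \<forall>t\<in>T. \<mu>1 t = density (\<mu>1 s) (\<lambda>x. ennreal (exp ((t - s) * x)))"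
    and evol2: "\<forall>s\<in>T. \<forall>t\<in>T. \<mu>2 t = density (\<mu>2 s) (\<lambda>y. ennreal (exp ((t - s) * y)))"
    and mom1: "\<forall>t\<in>T. \<forall>k::nat. integrable (\<mu>1 t) (\<lambda>x. x ^ k)"
    and mom2: "\<forall>t\<in>T. \<forall>k::nat. integrable (\<mu>2 t) (\<lambda>y. y ^ k)"
    and dmom1: "\<forall>t\<in>T. \<forall>k::nat.
       ((\<lambda>s. \<integral>x. x ^ k \<partial>\<mu>1 s) has_real_derivative (\<integral>x. x ^ Suc k \<partial>\<mu>1 t)) (at t)"
    and dmom2: "\<forall>t\<in>T. \<forall>k::nat.
       ((\<lambda>s. \<integral>y. y ^ k \<partial>\<mu>2 s) has_real_derivative (\<integral>y. y ^ Suc k \<partial>\<mu>2 t)) (at t)"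
    and nz: "\<forall>t\<in>T. \<forall>n. tau \<mu>1 \<mu>2 n t \<noteq> 0 \<and> sigma \<mu>1 \<mu>2 n t \<noteq> 0 \<and>
              sigma_hat \<mu>1 \<mu>2 n t \<noteq> 0 \<and> cC \<mu>1 \<mu>2 n t \<noteq> 0 \<and> cC_hat \<mu>1 \<mu>2 n t \<noteq> 0"
    and n2: "n \<ge> 2"
    and tT: "t \<in> T"
  shows
    "((\<lambda>s. cA \<mu>1 \<mu>2 n s) has_real_derivative
        cA \<mu>1 \<mu>2 n t * (cB \<mu>1 \<mu>2 n t + cB_hat \<mu>1 \<mu>2 n t
                         - cB \<mu>1 \<mu>2 (n - 1) t - cB_hat \<mu>1 \<mu>2 (n - 1) t)) (at t)
   \<and> ((\<lambda>s. cB \<mu>1 \<mu>2 n s) has_real_derivative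
        (cB \<mu>1 \<mu>2 (n - 1) t + cB_hat \<mu>1 \<mu>2 (n - 1) t) * cC_hat \<mu>1 \<mu>2 (n - 1) t
        - (cB \<mu>1 \<mu>2 n t + cB_hat \<mu>1 \<mu>2 n t) * cC_hat \<mu>1 \<mu>2 n t) (at t)
   \<and> ((\<lambda>s. cB_hat \<mu>1 \<mu>2 n s) has_real_derivative
        (cB \<mu>1 \<mu>2 (n - 1) t + cB_hat \<mu>1 \<mu>2 (n - 1) t) * cC \<mu>1 \<mu>2 (n - 1) t
        - (cB \<mu>1 \<mu>2 n t + cB_hat \<mu>1 \<mu>2 n t) * cC \<mu>1 \<mu>2 n t) (at t)
   \<and> ((\<lambda>s. cC \<mu>1 \<mu>2 n s) has_real_derivative
        cC \<mu>1 \<mu>2 n t * (cC \<mu>1 \<mu>2 n t - cA \<mu>1 \<mu>2 n t / cC \<mu>1 \<mu>2 (n - 1) t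
           - cB_hat \<mu>1 \<mu>2 n t - cC \<mu>1 \<mu>2 (Suc n) t
           + cA \<mu>1 \<mu>2 (Suc n) t / cC \<mu>1 \<mu>2 n t + cB_hat \<mu>1 \<mu>2 (Suc n) t)) (at t)
   \<and> ((\<lambda>s. cC_hat \<mu>1 \<mu>2 n s) has_real_derivative
        cC_hat \<mu>1 \<mu>2 n t * (cC_hat \<mu>1 \<mu>2 n t - cA \<mu>1 \<mu>2 n t / cC_hat \<mu>1 \<mu>2 (n - 1) t
           - cB \<mu>1 \<mu>2 n t - cC_hat \<mu>1 \<mu>2 (Suc n) t
           + cA \<mu>1 \<mu>2 (Suc n) t / cC_hat \<mu>1 \<mu>2 n t + cB \<mu>1 \<mu>2 (Suc n) t)) (at t)"
proof -
  let ?F = "\<lambda>s. cauchy_moment (\<mu>1 s) (\<mu>2 s)"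
  let ?\<alpha> = "\<lambda>s i. \<integral>x. x ^ i \<partial>\<mu>1 s" and ?\<beta> = "\<lambda>s j. \<integral>y. y ^ j \<partial>\<mu>2 s"
  have W: "cauchy_weights (\<mu>1 s) (\<mu>2 s)" if s: "s \<in> T" for s
  proof -
    have "finite_measure (\<mu>1 s)" "finite_measure (\<mu>2 s)"
      by (rule finite_measure_if_integrable_1; use mom1 mom2 s in \<open>force dest: bspec spec[of _ 0]\<close>)+
    then have "sigma_finite_measure (\<mu>1 s)" "sigma_finite_measure (\<mu>2 s)"
      by (simp_all add: finite_measure_def)
    \<comment> \<open>Integrability of the kernel is extracted from the nonvanishing of the first
      tau.\<close>
    then have "integrable (\<mu>1 s \<Otimes>\<^sub>M \<mu>2 s) (\<lambda>p. 1 / (fst p + snd p))"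
      using s sets1 sets2 nz by (intro integrable_cauchy_kernel_if_tau_nonzero) auto
    then show ?thesis
      using s sets1 sets2 pos1 pos2 mom1 mom2 by (intro cauchy_weights.intro) auto
  qed
  have tau_nz: "tau \<mu>1 \<mu>2 n s \<noteq> 0" and sigma_nz: "sigma \<mu>1 \<mu>2 n s \<noteq> 0"
    and sigma_hat_nz: "sigma_hat \<mu>1 \<mu>2 n s \<noteq> 0" if "s \<in> T" for n s
    using nz that by auto
  have transp_F: "cauchy_moment (\<mu>2 s) (\<mu>1 s) i l = ?F s l i" if "s \<in> T" for s i l
  proof -
    interpret cauchy_weights "\<mu>1 s" "\<mu>2 s" by (rule W[OF that])
    show ?thesis by (intro cauchy_moment_swap sigma_finite_weights sets_M sets_N)
  qed
  note swap = cint_functions_swap[of \<mu>1 _ \<mu>2, OF W]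
  \<comment> \<open>For the exchanged measures the array of \<open>cint_elim\<close> has the
    exponents of \<open>x\<close> as rows, so it is \<open>?F\<close> itself.\<close>
  have tau: "tau \<mu>1 \<mu>2 n s = (\<Prod>k<n. elim (?F s) k k k)"
    and pivot: "elim (?F s) n n n \<noteq> 0"
    and sigma: "sigma \<mu>1 \<mu>2 n s = tau \<mu>1 \<mu>2 n s * elim_row (?F s) (?\<beta> s) n n"
    and xi: "xi \<mu>1 \<mu>2 n s / tau \<mu>1 \<mu>2 n s = elim_coeff (?F s) (?F s n) n"
    if s: "s \<in> T" for n s
    using cint_elim[of \<mu>2 s \<mu>1, OF cauchy_weights_swap[OF W[OF s]]] tau_nz[OF s]
    by (simp_all add: swap[OF s] transp_F[OF s])
  have sigma_hat: "sigma_hat \<mu>1 \<mu>2 n s = tau \<mu>1 \<mu>2 n s * elim_row (transposed (?F s)) (?\<alpha> s) n n"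
    and xi_hat: "xi_hat \<mu>1 \<mu>2 n s / tau \<mu>1 \<mu>2 n s = elim_coeff (transposed (?F s)) (transposed (?F s) n) n"
    if s: "s \<in> T" for n s
    using cint_elim(3,4)[of \<mu>1 s \<mu>2, OF W[OF s]] tau_nz[OF s] by simp_all
  have row: "elim_row (?F t) (?\<beta> t) n n \<noteq> 0" and col: "elim_row (transposed (?F t)) (?\<alpha> t) n n \<noteq> 0" for n
    using sigma[OF tT] sigma_nz[OF tT] sigma_hat[OF tT] sigma_hat_nz[OF tT] by auto
  have dF: "((\<lambda>s. ?F s i j) has_real_derivative ?\<alpha> t i * ?\<beta> t j) (at t)" for i j
  proof (rule has_real_derivative_sandwich[OF T_open tT, where a = "\<lambda>s. ?\<alpha> s i * ?\<beta> s j"])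
    show "isCont (\<lambda>s. ?\<alpha> s i * ?\<beta> s j) t"
      using dmom1 dmom2 tT by (intro continuous_intros) (blast intro: DERIV_isCont)+
    fix s assume s: "s \<in> T"
    \<comment> \<open>The measures at \<open>s\<close> are those at \<open>t\<close> tilted by
      \<open>s - t\<close>, so the tilt bounds are the two sides of the sandwich.\<close>
    have "\<mu>1 s = density (\<mu>1 t) (\<lambda>x. ennreal (exp ((s - t) * x)))"
      "\<mu>2 s = density (\<mu>2 t) (\<lambda>x. ennreal (exp ((s - t) * x)))"
      using evol1 evol2 s tT by blast+
    from cauchy_moment_tilt_bounds[OF W[OF tT] W[OF s] this]
    show "(s - t) * (?\<alpha> t i * ?\<beta> t j) \<le> ?F s i j - ?F t i j"
      "?F s i j - ?F t i j \<le> (s - t) * (?\<alpha> s i * ?\<beta> s j)" by blast+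
  qed
  have shift: "?F t (Suc i) j + ?F t i (Suc j) = ?\<alpha> t i * ?\<beta> t j" for i j
    by (rule cauchy_weights.cauchy_moment_shift[OF W[OF tT]])
  interpret W: moment_flow ?F ?\<alpha> ?\<beta> t
    by unfold_locales (use dF dmom2 tT shift pivot[OF tT] row col in auto)
  \<comment> \<open>The mirrored instance; it supplies the equations for \<open>cB_hat\<close> and
    \<open>cC_hat\<close>.\<close>
  interpret S: moment_flow "\<lambda>s. transposed (?F s)" ?\<beta> ?\<alpha> t
  proof unfold_locales
    show "((\<lambda>s. ?F s j i) has_real_derivative ?\<beta> t i * ?\<alpha> t j) (at t)" for i j
      using dF by (simp add: mult.commute)
    show "?F t j (Suc i) + ?F t (Suc j) i = ?\<beta> t i * ?\<alpha> t j" for i j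
      using shift[of j i] by (simp add: mult.commute add.commute)
  qed (use dmom1 tT pivot[OF tT] row col in \<open>auto simp: elim_transp[of "?F t"]\<close>)
  have S: "S.piv = W.piv" "S.acol = W.brow" "S.brow = W.acol" "S.lcoeff = W.rcoeff" "S.rcoeff = W.lcoeff"
    by (simp_all add: fun_eq_iff S.piv_def W.piv_def S.acol_def W.acol_def S.brow_def W.brow_def
        S.lcoeff_def W.lcoeff_def S.rcoeff_def W.rcoeff_def elim_transp[of "?F _"])
  obtain m where n: "n = Suc m" using n2 by (cases n) auto
  have A: "cA \<mu>1 \<mu>2 (Suc k) s = W.piv (Suc k) s / W.piv k s" if s: "s \<in> T" for k s
    using tau_nz[OF s, of k] pivot[OF s, of k]
    by (simp add: cA_def tau[OF s] W.piv_def power2_eq_square)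
  have B: "cB \<mu>1 \<mu>2 k s = W.lcoeff (Suc k) s - W.lcoeff k s"
    and B_hat: "cB_hat \<mu>1 \<mu>2 k s = W.rcoeff (Suc k) s - W.rcoeff k s" if s: "s \<in> T" for k s
    unfolding cB_def cB_hat_def xi[OF s] xi_hat[OF s] W.lcoeff_def W.rcoeff_def by simp_all
  have C: "cC \<mu>1 \<mu>2 k s = - W.brow (Suc k) s / W.brow k s"
    and C_hat: "cC_hat \<mu>1 \<mu>2 k s = - W.acol (Suc k) s / W.acol k s" if s: "s \<in> T" for k s
    using tau_nz[OF s, of k] tau_nz[OF s, of "Suc k"]
    by (simp_all add: cC_def cC_hat_def sigma[OF s] sigma_hat[OF s] W.brow_def W.acol_def del: elim_row.simps)
  \<comment> \<open>The formulas for A, B and C are known on \<open>T\<close> only, but this is an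
    open neighbourhood of \<open>t\<close>.\<close>
  note transfer = has_field_derivative_transform_within_open[OF _ T_open tT]
  show ?thesis
    unfolding n diff_Suc_1 A[OF tT] B[OF tT] B_hat[OF tT] C[OF tT] C_hat[OF tT]
  proof (intro conjI, goal_cases)
    case 1
    show ?case by (rule transfer[OF W.DERIV_piv_quotient]) (simp add: A)
  next
    case 2
    show ?case by (rule transfer[OF W.DERIV_lcoeff_diff]) (simp add: B)
  next
    case 3
    show ?case by (rule transfer[OF DERIV_cong[OF S.DERIV_lcoeff_diff[of m, unfolded S]]])
      (simp_all add: B_hat algebra_simps)
  next
    case 4
    show ?case by (rule transfer[OF W.DERIV_brow_quotient]) (simp add: C)
  next
    case 5
    show ?case by (rule transfer[OF S.DERIV_brow_quotient[unfolded S]]) (simp add: C_hat)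
  qed
qed

end
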